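(* Let $\mathcal{H}_1,\dots,\mathcal{H}_n$ be complex Hilbert spaces, let $\mathbb{S}=[S_{ij}]$ be an $n\times n$ operator matrix acting on $\bigoplus_{i=1}^n\mathcal{H}_i$, where $S_{ij}\in\mathcal{B}(\mathcal{H}_j,\mathcal{H}_i)$ for $1\le i,j\le n$, and let $f,g$ be non-negative continuous functions on $[0,\infty)$ satisfying $f(t)g(t)=t$ for all $t\ge 0$. Then for all $s\ge 1$, $$\omega^{s}(\mathbb{S})\le n^{2s-2}\,\omega\left([s_{ij}]\right),\qquad s_{ij}=\begin{cases}\frac12\,\omega\left(f^{2s}(|S_{ii}|)+g^{2s}(|S_{ii}^*|)\right), & i=j,\\ \|S_{ij}\|^{s}, & i\ne j,\end{cases}$$ where $[s_{ij}]$ is regarded as an $n\times n$ complex matrix acting on $\mathbb{C}^n$.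
   Context: $\mathcal{B}(\mathcal{H}_j,\mathcal{H}_i)$ is the space of bounded linear operators from $\mathcal{H}_j$ to $\mathcal{H}_i$, and $\|\cdot\|$ is the operator norm. The numerical radius of a bounded operator $A$ on a complex Hilbert space is $\omega(A)=\sup_{\|x\|=1}|\langle Ax,x\rangle|$, and $\omega^s(A)=(\omega(A))^s$. $|A|=(A^*A)^{1/2}$. For a positive operator $P$, $f^{s}(P)=(f(P))^{s}$ is defined by the continuous functional calculus. *)

theory Defs
  imports "HOL-Analysis.Analysis" "Jordan_Normal_Form.VS_Connect"
begin

text \<open>
  The spaces of the family may be unrelated, so a complex Hilbert space is a structure with an
  explicit carrier rather than a type of a type class: a complex vector space in the sense of
  \<open>vectorspace\<close> together with an inner product, linear in its first argument. As for
  \<open>module_vec\<close>, the multiplicative fields inherited from rings are irrelevant.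
\<close>

record 'a cinner_space = "(complex, 'a) module" +
  cinner :: "'a \<Rightarrow> 'a \<Rightarrow> complex"

definition hnorm :: "'a cinner_space \<Rightarrow> 'a \<Rightarrow> real" where
  "hnorm V x = sqrt (Re (cinner V x x))"

locale complex_hilbert = vectorspace "class_ring :: complex ring" V
  for V :: "'a cinner_space" +
  assumes cinner_add: "\<lbrakk>x \<in> carrier V; y \<in> carrier V; z \<in> carrier V\<rbrakk>
      \<Longrightarrow> cinner V (x \<oplus>\<^bsub>V\<^esub> y) z = cinner V x z + cinner V y z"
    and cinner_smult: "\<lbrakk>x \<in> carrier V; y \<in> carrier V\<rbrakk>
      \<Longrightarrow> cinner V (c \<odot>\<^bsub>V\<^esub> x) y = c * cinner V x y"
    and cinner_commute: "\<lbrakk>x \<in> carrier V; y \<in> carrier V\<rbrakk>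
      \<Longrightarrow> cinner V y x = cnj (cinner V x y)"
    and cinner_pos: "\<lbrakk>x \<in> carrier V; x \<noteq> \<zero>\<^bsub>V\<^esub>\<rbrakk> \<Longrightarrow> 0 < Re (cinner V x x)"
    and complete: "\<lbrakk>\<And>n. X n \<in> carrier V;
        \<And>e. 0 < e \<Longrightarrow> \<exists>N. \<forall>m\<ge>N. \<forall>n\<ge>N. hnorm V (X m \<ominus>\<^bsub>V\<^esub> X n) < e\<rbrakk>
      \<Longrightarrow> \<exists>L\<in>carrier V. (\<lambda>n::nat. hnorm V (X n \<ominus>\<^bsub>V\<^esub> L)) \<longlonglongrightarrow> 0"

text \<open>
  Operators are functions that are \<open>undefined\<close> off the carrier of their domain, so that equality of
  operators is equality of functions.
\<close>

definition bounded_ops :: "'a cinner_space \<Rightarrow> 'b cinner_space \<Rightarrow> ('a \<Rightarrow> 'b) set" where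
  "bounded_ops V W = {T \<in> module_hom (class_ring :: complex ring) V W \<inter> extensional (carrier V).
     \<exists>c. \<forall>x\<in>carrier V. hnorm W (T x) \<le> c * hnorm V x}"

definition op_norm :: "'a cinner_space \<Rightarrow> 'b cinner_space \<Rightarrow> ('a \<Rightarrow> 'b) \<Rightarrow> real" where
  "op_norm V W T = Sup {hnorm W (T x) | x. x \<in> carrier V \<and> hnorm V x \<le> 1}"

text \<open>
  All members of the set are nonnegative; the extra \<open>0\<close> only fixes the value of the supremum over
  the empty set, which occurs exactly on the zero space.
\<close>

definition numerical_radius :: "'a cinner_space \<Rightarrow> ('a \<Rightarrow> 'a) \<Rightarrow> real" where
  "numerical_radius V T =
     Sup (insert 0 {cmod (cinner V (T x) x) | x. x \<in> carrier V \<and> hnorm V x = 1})"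

definition op_add :: "'a cinner_space \<Rightarrow> 'b cinner_space \<Rightarrow> ('a \<Rightarrow> 'b) \<Rightarrow> ('a \<Rightarrow> 'b) \<Rightarrow> 'a \<Rightarrow> 'b" where
  "op_add V W S T = (\<lambda>x\<in>carrier V. S x \<oplus>\<^bsub>W\<^esub> T x)"

definition op_diff :: "'a cinner_space \<Rightarrow> 'b cinner_space \<Rightarrow> ('a \<Rightarrow> 'b) \<Rightarrow> ('a \<Rightarrow> 'b) \<Rightarrow> 'a \<Rightarrow> 'b" where
  "op_diff V W S T = (\<lambda>x\<in>carrier V. S x \<ominus>\<^bsub>W\<^esub> T x)"

definition adjoint_op :: "'a cinner_space \<Rightarrow> 'b cinner_space \<Rightarrow> ('a \<Rightarrow> 'b) \<Rightarrow> 'b \<Rightarrow> 'a" where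
  "adjoint_op V W T = (THE R. R \<in> bounded_ops W V \<and>
     (\<forall>x\<in>carrier V. \<forall>y\<in>carrier W. cinner W (T x) y = cinner V x (R y)))"

definition op_spectrum :: "'a cinner_space \<Rightarrow> ('a \<Rightarrow> 'a) \<Rightarrow> complex set" where
  "op_spectrum V T = {l. \<not> (\<exists>R\<in>bounded_ops V V.
     let D = op_diff V V (\<lambda>x\<in>carrier V. l \<odot>\<^bsub>V\<^esub> x) T in
     compose (carrier V) R D = (\<lambda>x\<in>carrier V. x) \<and>
     compose (carrier V) D R = (\<lambda>x\<in>carrier V. x))}"

definition op_poly :: "'a cinner_space \<Rightarrow> real poly \<Rightarrow> ('a \<Rightarrow> 'a) \<Rightarrow> 'a \<Rightarrow> 'a" where
  "op_poly V p T = (\<lambda>x\<in>carrier V.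
     finsum V (\<lambda>k. complex_of_real (coeff p k) \<odot>\<^bsub>V\<^esub> (T ^^ k) x) {..degree p})"

text \<open>
  Continuous functional calculus of a self-adjoint operator \<open>P\<close>: the norm limit of \<open>p\<^sub>k(P)\<close> for real
  polynomials \<open>p\<^sub>k\<close> converging to \<open>f\<close> uniformly on the spectrum, which is then contained in the real
  line. The limit does not depend on the choice of the \<open>p\<^sub>k\<close>.
\<close>

definition op_fun :: "'a cinner_space \<Rightarrow> (real \<Rightarrow> real) \<Rightarrow> ('a \<Rightarrow> 'a) \<Rightarrow> 'a \<Rightarrow> 'a" where
  "op_fun V f P = (THE T. T \<in> bounded_ops V V \<and>
     (\<exists>p :: nat \<Rightarrow> real poly.
        uniform_limit {t. complex_of_real t \<in> op_spectrum V P} (\<lambda>k. poly (p k)) f sequentially \<and>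
        (\<lambda>k. op_norm V V (op_diff V V (op_poly V (p k) P) T)) \<longlonglongrightarrow> 0))"

definition op_powr :: "'a cinner_space \<Rightarrow> ('a \<Rightarrow> 'a) \<Rightarrow> real \<Rightarrow> 'a \<Rightarrow> 'a" where
  "op_powr V P r = op_fun V (\<lambda>t. t powr r) P"

definition op_abs :: "'a cinner_space \<Rightarrow> 'b cinner_space \<Rightarrow> ('a \<Rightarrow> 'b) \<Rightarrow> 'a \<Rightarrow> 'a" where
  "op_abs V W T = op_powr V (compose (carrier V) (adjoint_op V W T) T) (1/2)"

definition hilbert_sum :: "'i set \<Rightarrow> ('i \<Rightarrow> 'a cinner_space) \<Rightarrow> ('i \<Rightarrow> 'a) cinner_space" where
  "hilbert_sum I H = \<lparr>
     carrier = (\<Pi>\<^sub>E i\<in>I. carrier (H i)),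
     mult = undefined,
     one = undefined,
     zero = (\<lambda>i\<in>I. \<zero>\<^bsub>H i\<^esub>),
     add = (\<lambda>x y. \<lambda>i\<in>I. x i \<oplus>\<^bsub>H i\<^esub> y i),
     smult = (\<lambda>c x. \<lambda>i\<in>I. c \<odot>\<^bsub>H i\<^esub> x i),
     cinner = (\<lambda>x y. \<Sum>i\<in>I. cinner (H i) (x i) (y i))\<rparr>"

definition op_matrix ::
  "'i set \<Rightarrow> ('i \<Rightarrow> 'a cinner_space) \<Rightarrow> ('i \<Rightarrow> 'i \<Rightarrow> 'a \<Rightarrow> 'a) \<Rightarrow> ('i \<Rightarrow> 'a) \<Rightarrow> 'i \<Rightarrow> 'a" where
  "op_matrix I H S =
     (\<lambda>x\<in>carrier (hilbert_sum I H). \<lambda>i\<in>I. finsum (H i) (\<lambda>j. S i j (x j)) I)"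

definition cvec_space :: "nat \<Rightarrow> complex vec cinner_space" where
  "cvec_space n = module.extend (module_vec TYPE(complex) n)
     (cinner_space.fields (\<lambda>x y. scalar_prod x (conjugate y)))"

definition mat_op :: "nat \<Rightarrow> complex mat \<Rightarrow> complex vec \<Rightarrow> complex vec" where
  "mat_op n A = (\<lambda>x\<in>carrier (cvec_space n). A *\<^sub>v x)"

end

theory Submission
  imports Defs "HOL-Computational_Algebra.Fundamental_Theorem_Algebra"
begin

text \<open>
  For a unit vector \<open>x = (x\<^sub>i)\<close>, the form \<open>\<langle>S x, x\<rangle>\<close> is a sum of the \<open>n\<^sup>2\<close> terms \<open>\<langle>S\<^sub>i\<^sub>j x\<^sub>j, x\<^sub>i\<rangle>\<close>, so the
  power mean inequality bounds \<open>\<bar>\<langle>S x, x\<rangle>\<bar>\<^sup>s\<close> by \<open>n\<^bsup>2s-2\<^esup>\<close> times the sum of their \<open>s\<close>-th powers.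
  Off the diagonal the Cauchy--Schwarz inequality gives \<open>\<parallel>S\<^sub>i\<^sub>j\<parallel>\<^sup>s \<parallel>x\<^sub>j\<parallel> \<parallel>x\<^sub>i\<parallel>\<close>. On the diagonal, the mixed
  Schwarz inequality \<open>\<bar>\<langle>T x, x\<rangle>\<bar> \<le> \<parallel>f(|T|) x\<parallel> \<parallel>g(|T*|) x\<parallel>\<close>, the AM-GM inequality and McCarthy's
  inequality \<open>\<langle>P x, x\<rangle>\<^sup>s \<le> \<langle>P\<^sup>s x, x\<rangle>\<close> for \<open>\<parallel>x\<parallel> \<le> 1\<close> give the bound by \<open>s\<^sub>i\<^sub>i \<parallel>x\<^sub>i\<parallel>\<^sup>2\<close>. What remains is the
  form of \<open>[s\<^sub>i\<^sub>j]\<close> at the unit vector \<open>(\<parallel>x\<^sub>i\<parallel>)\<close>.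

  The functional calculus rests on \<open>\<parallel>p(P)\<parallel> \<le> sup |p|\<close> over the spectrum, for self-adjoint \<open>P\<close> and real
  polynomials \<open>p\<close>, which makes the limits exist and independent of the approximating polynomials.
\<close>

section \<open>Inner product calculus and the Lax--Milgram lemma\<close>

text \<open>The components of a unit vector have norm at most 1, and the estimates are made for such
  vectors: there \<open>z powr s \<le> z\<close> holds for \<open>s \<ge> 1\<close>, so the sum of
  s-th powers stays below a quadratic form in the norms. The constant is the power
  \<open>s - 1\<close> of the number \<open>n\<^sup>2\<close> of terms.

  Adjoints and functions of operators are definite descriptions, so existence and uniqueness come
  before any use of them. One variational lemma serves twice: with the identity it is the Riesz
  theorem behind adjoints, and with t - P it gives the inverses that confine the spectrum to an
  interval. Limits are constructed by approximation on that interval, but uniqueness concerns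
  polynomials controlled on the spectrum only; this forces the sharp norm bound over the spectrum.
  It is obtained from the factorisation of a polynomial.

  The root, f and the power are nested calculi. They collapse to one function of the adjoint of T
  times T, so that the mixed Schwarz inequality only has to relate the two compositions of T with
  its adjoint.\<close>

locale hilbert_space = complex_hilbert V for V :: "'a cinner_space" (structure)
begin

abbreviation ip :: "'a \<Rightarrow> 'a \<Rightarrow> complex" where "ip \<equiv> cinner V"
abbreviation nrm :: "'a \<Rightarrow> real" where "nrm \<equiv> hnorm V"
abbreviation C :: "'a set" where "C \<equiv> carrier V"

lemma smult_in [simp]: "x \<in> C \<Longrightarrow> c \<odot> x \<in> C"
  using smult_closed[of c x] by simp

lemma minus_in [simp]: "x \<in> C \<Longrightarrow> y \<in> C \<Longrightarrow> x \<ominus> y \<in> C"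
  by (rule module.M.minus_closed)

lemma a_inv_eq_smult: "x \<in> C \<Longrightarrow> \<ominus> x = (-1) \<odot> x"
  using module.smult_l_minus[of 1 x] module.smult_one[of x] by (simp add: class_ring_simps)

lemma minus_eq_smult: "x \<in> C \<Longrightarrow> y \<in> C \<Longrightarrow> x \<ominus> y = x \<oplus> (-1) \<odot> y"
  by (simp add: a_minus_def a_inv_eq_smult)

lemma ip_add_left [simp]:
  "x \<in> C \<Longrightarrow> y \<in> C \<Longrightarrow> z \<in> C \<Longrightarrow> ip (x \<oplus> y) z = ip x z + ip y z"
  by (rule cinner_add)

lemma ip_smult_left [simp]: "x \<in> C \<Longrightarrow> z \<in> C \<Longrightarrow> ip (c \<odot> x) z = c * ip x z"
  by (rule cinner_smult)

lemma ip_minus_left [simp]: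
  "x \<in> C \<Longrightarrow> y \<in> C \<Longrightarrow> z \<in> C \<Longrightarrow> ip (x \<ominus> y) z = ip x z - ip y z"
  by (simp add: minus_eq_smult)

lemma ip_zero_left [simp]: "z \<in> C \<Longrightarrow> ip \<zero> z = 0"
  using ip_add_left[of \<zero> \<zero> z] by simp

lemma ip_add_right [simp]:
  "x \<in> C \<Longrightarrow> y \<in> C \<Longrightarrow> z \<in> C \<Longrightarrow> ip z (x \<oplus> y) = ip z x + ip z y"
  by (subst (1 2 3) cinner_commute) auto

lemma ip_smult_right [simp]: "x \<in> C \<Longrightarrow> z \<in> C \<Longrightarrow> ip z (c \<odot> x) = cnj c * ip z x"
  by (subst (1 2) cinner_commute) auto

lemma ip_minus_right [simp]:
  "x \<in> C \<Longrightarrow> y \<in> C \<Longrightarrow> z \<in> C \<Longrightarrow> ip z (x \<ominus> y) = ip z x - ip z y"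
  by (subst (1 2 3) cinner_commute) auto

lemma ip_zero_right [simp]: "z \<in> C \<Longrightarrow> ip z \<zero> = 0"
  by (subst cinner_commute) auto

lemma Im_ip_self [simp]: "x \<in> C \<Longrightarrow> Im (ip x x) = 0"
  using cinner_commute[of x x] by (simp add: complex_eq_iff)

lemma Re_ip_self_nonneg [simp]: "x \<in> C \<Longrightarrow> 0 \<le> Re (ip x x)"
  by (cases "x = \<zero>") (auto intro: less_imp_le cinner_pos)

lemma nrm_sq: "x \<in> C \<Longrightarrow> (nrm x)\<^sup>2 = Re (ip x x)"
  by (simp add: hnorm_def)

lemma ip_self: "x \<in> C \<Longrightarrow> ip x x = complex_of_real ((nrm x)\<^sup>2)"
  by (simp add: nrm_sq complex_eq_iff)

lemma nrm_nonneg [simp]: "x \<in> C \<Longrightarrow> 0 \<le> nrm x"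
  by (simp add: hnorm_def)

lemma nrm_zero [simp]: "nrm \<zero> = 0"
  by (simp add: hnorm_def)

lemma nrm_eq_0: "x \<in> C \<Longrightarrow> nrm x = 0 \<longleftrightarrow> x = \<zero>"
  using cinner_pos[of x] by (cases "x = \<zero>") (auto simp: hnorm_def)

lemma minus_eq_zero_iff: "x \<in> C \<Longrightarrow> y \<in> C \<Longrightarrow> x \<ominus> y = \<zero> \<longleftrightarrow> x = y"
proof
  assume *: "x \<in> C" "y \<in> C" "x \<ominus> y = \<zero>"
  have "x = (x \<ominus> y) \<oplus> y"
    using *(1,2) by (simp only: a_minus_def module.M.a_assoc module.M.l_neg module.M.r_zero module.M.a_inv_closed)
  also have "\<dots> = y" using *(2) by (simp only: *(3) module.M.l_zero)
  finally show "x = y" .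
qed (simp add: a_minus_def module.M.r_neg)

text \<open>Testing against every vector turns a vector identity into an identity of complex
  numbers, which \<open>simp\<close> can handle; most module arithmetic below goes through
  this.\<close>

lemma ip_eqI:
  assumes "x \<in> C" "y \<in> C" "\<And>z. z \<in> C \<Longrightarrow> ip x z = ip y z"
  shows "x = y"
proof -
  have "ip (x \<ominus> y) (x \<ominus> y) = 0" using assms by simp
  then have "nrm (x \<ominus> y) = 0" by (simp add: hnorm_def)
  then show ?thesis using assms nrm_eq_0 minus_eq_zero_iff by simp
qed

lemma nrm_smult: "x \<in> C \<Longrightarrow> nrm (c \<odot> x) = cmod c * nrm x"
proof -
  assume x: "x \<in> C"
  have csq: "(cmod c)\<^sup>2 = Re c * Re c + Im c * Im c"
    by (simp add: cmod_power2 flip: power2_eq_square)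
  have "Re (ip (c \<odot> x) (c \<odot> x)) = (cmod c)\<^sup>2 * Re (ip x x)"
    using x csq by (simp add: ring_distribs flip: mult.assoc)
  then show ?thesis
    by (simp add: hnorm_def real_sqrt_mult)
qed

lemma nrm_add_sq:
  "x \<in> C \<Longrightarrow> y \<in> C \<Longrightarrow> (nrm (x \<oplus> y))\<^sup>2 = (nrm x)\<^sup>2 + 2 * Re (ip x y) + (nrm y)\<^sup>2"
  using cinner_commute[of x y] by (simp add: nrm_sq)

lemma nrm_minus_sq:
  "x \<in> C \<Longrightarrow> y \<in> C \<Longrightarrow> (nrm (x \<ominus> y))\<^sup>2 = (nrm x)\<^sup>2 - 2 * Re (ip x y) + (nrm y)\<^sup>2"
  using cinner_commute[of x y] by (simp add: nrm_sq)

lemma nrm_minus_commute: "x \<in> C \<Longrightarrow> y \<in> C \<Longrightarrow> nrm (x \<ominus> y) = nrm (y \<ominus> x)"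
  using cinner_commute[of x y] by (simp add: hnorm_def)

lemma cauchy_schwarz:
  assumes x: "x \<in> C" and y: "y \<in> C"
  shows "cmod (ip x y) \<le> nrm x * nrm y"
proof (cases "nrm y = 0")
  case True
  then show ?thesis using x y by (simp add: nrm_eq_0)
next
  case False
  define N where "N = (nrm y)\<^sup>2"
  have N: "N > 0" using False by (simp add: N_def)
  \<comment> \<open>The coefficient of the orthogonal projection of x onto y; the inequality is
    nonnegativity of the squared norm of the remainder.\<close>
  define c where "c = ip x y / of_real N"
  have yx: "ip y x = cnj (ip x y)" by (rule cinner_commute[OF x y])
  have "0 \<le> Re (ip (x \<ominus> c \<odot> y) (x \<ominus> c \<odot> y))"
    using x y by (intro Re_ip_self_nonneg) simp
  also have "ip (x \<ominus> c \<odot> y) (x \<ominus> c \<odot> y)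
      = ip x x - cnj c * ip x y - c * cnj (ip x y) + c * cnj c * of_real N"
    using x y by (simp add: yx ip_self[OF y] N_def algebra_simps)
  also have "\<dots> = ip x x - ip x y * cnj (ip x y) / of_real N"
    using N by (simp add: c_def field_simps)
  also have "ip x y * cnj (ip x y) = of_real ((cmod (ip x y))\<^sup>2)"
    by (simp only: complex_norm_square)
  finally have "0 \<le> (nrm x)\<^sup>2 - (cmod (ip x y))\<^sup>2 / N"
    using x by (simp add: ip_self flip: of_real_power of_real_divide)
  then have "(cmod (ip x y))\<^sup>2 \<le> (nrm x * nrm y)\<^sup>2"
    using N by (simp add: field_simps N_def)
  then show ?thesis using x y by (simp add: power2_le_iff_abs_le)
qed

lemma Re_ip_le: "x \<in> C \<Longrightarrow> y \<in> C \<Longrightarrow> \<bar>Re (ip x y)\<bar> \<le> nrm x * nrm y"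
  using abs_Re_le_cmod cauchy_schwarz order_trans by blast

lemma nrm_triangle: "x \<in> C \<Longrightarrow> y \<in> C \<Longrightarrow> nrm (x \<oplus> y) \<le> nrm x + nrm y"
  by (rule power2_le_imp_le) (use Re_ip_le[of x y] in \<open>auto simp: nrm_add_sq power2_sum\<close>)

lemma nrm_triangle_minus: "x \<in> C \<Longrightarrow> y \<in> C \<Longrightarrow> nrm (x \<ominus> y) \<le> nrm x + nrm y"
  by (simp add: minus_eq_smult order_trans[OF nrm_triangle] nrm_smult)

lemma nrm_triangle_minus_mid:
  "x \<in> C \<Longrightarrow> y \<in> C \<Longrightarrow> z \<in> C \<Longrightarrow> nrm (x \<ominus> z) \<le> nrm (x \<ominus> y) + nrm (y \<ominus> z)"
proof -
  assume *: "x \<in> C" "y \<in> C" "z \<in> C"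
  have "x \<ominus> z = (x \<ominus> y) \<oplus> (y \<ominus> z)"
    by (rule ip_eqI) (use * in auto)
  then show ?thesis using nrm_triangle * by simp
qed

lemma nrm_le_minus: "x \<in> C \<Longrightarrow> y \<in> C \<Longrightarrow> nrm x \<le> nrm (x \<ominus> y) + nrm y"
  using nrm_triangle_minus_mid[of x y \<zero>] by (simp add: minus_eq_smult)

text \<open>The representing vector minimises the convex functional \<open>Re \<langle>D x, x\<rangle> - 2 Re (\<phi> x)\<close>; by
  coercivity a minimising sequence is Cauchy.\<close>

lemma lax_milgram_selfadjoint:
  assumes D: "\<And>x. x \<in> C \<Longrightarrow> D x \<in> C"
    and D_add: "\<And>x y. x \<in> C \<Longrightarrow> y \<in> C \<Longrightarrow> D (x \<oplus> y) = D x \<oplus> D y"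
    and D_smult: "\<And>c x. x \<in> C \<Longrightarrow> D (c \<odot> x) = c \<odot> D x"
    and D_bound: "\<And>x. x \<in> C \<Longrightarrow> nrm (D x) \<le> B * nrm x"
    and D_self: "\<And>x y. x \<in> C \<Longrightarrow> y \<in> C \<Longrightarrow> ip (D x) y = ip x (D y)"
    and m: "m > 0" "\<And>x. x \<in> C \<Longrightarrow> m * (nrm x)\<^sup>2 \<le> Re (ip (D x) x)"
    and f_add: "\<And>x y. x \<in> C \<Longrightarrow> y \<in> C \<Longrightarrow> \<phi> (x \<oplus> y) = \<phi> x + \<phi> y"
    and f_smult: "\<And>c x. x \<in> C \<Longrightarrow> \<phi> (c \<odot> x) = c * \<phi> x"
    and f_bound: "\<And>x. x \<in> C \<Longrightarrow> cmod (\<phi> x) \<le> K * nrm x"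
  shows "\<exists>z\<in>C. \<forall>x\<in>C. \<phi> x = ip x (D z)"
proof -
  define J where "J = (\<lambda>x. Re (ip (D x) x) - 2 * Re (\<phi> x))"
  \<comment> \<open>Self-adjointness gives the two mixed terms of the quadratic form the same real
    part, whence the factor 2.\<close>
  have J_expand: "J (x \<oplus> w) = J x + Re (ip (D w) w) + 2 * (Re (ip w (D x)) - Re (\<phi> w))"
    if "x \<in> C" "w \<in> C" for x w
    using that cinner_commute[of w "D x"] D D_self[of w x]
    by (simp add: J_def D_add f_add algebra_simps)
  \<comment> \<open>Coercivity and the bound on \<phi> reduce this to completing the square in
    \<open>m * nrm x - K\<close>.\<close>
  have J_below: "- (K\<^sup>2 / m) \<le> J x" if x: "x \<in> C" for x
  proof -
    have "J x \<ge> m * (nrm x)\<^sup>2 - 2 * (K * nrm x)"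
      using m(2)[OF x] f_bound[OF x] abs_Re_le_cmod[of "\<phi> x"] by (simp add: J_def)
    moreover have "m * (nrm x)\<^sup>2 - 2 * (K * nrm x) + K\<^sup>2 / m = (m * nrm x - K)\<^sup>2 / m"
      using m(1) by (simp add: field_simps power2_eq_square)
    moreover have "(m * nrm x - K)\<^sup>2 / m \<ge> 0" using m(1) by simp
    ultimately show ?thesis by linarith
  qed
  define d where "d = Inf (J ` C)"
  have bdd: "bdd_below (J ` C)" using J_below by (auto simp: bdd_below_def)
  have d_le: "d \<le> J x" if "x \<in> C" for x
    unfolding d_def by (rule cInf_lower) (use that bdd in auto)
  have "\<exists>x\<in>C. J x < d + e" if "e > 0" for e
    using cInf_lessD[of "J ` C" "d + e"] that unfolding d_def by auto
  then have "\<exists>x\<in>C. J x < d + inverse (real (Suc n))" for n by simp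
  then obtain X where X: "\<And>n. X n \<in> C" "\<And>n. J (X n) < d + inverse (real (Suc n))"
    by metis
  \<comment> \<open>Parallelogram argument: h is the midpoint and w half the difference, so the
    linear terms at w and -w cancel. The constant is \<open>2 * m\<close> times the square of
    1/2.\<close>
  have par: "m / 2 * (nrm (x \<ominus> y))\<^sup>2 \<le> J x + J y - 2 * d" if x: "x \<in> C" and y: "y \<in> C" for x y
  proof -
    define h where "h = (1/2) \<odot> (x \<oplus> y)"
    define w where "w = (1/2) \<odot> (x \<ominus> y)"
    have h: "h \<in> C" and w: "w \<in> C" and w': "(-1) \<odot> w \<in> C"
      using x y by (auto simp: h_def w_def)
    have "x = h \<oplus> w" "y = h \<oplus> (-1) \<odot> w"
      by (rule ip_eqI; use x y in \<open>simp add: h_def w_def algebra_simps\<close>)+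
    then have "J x + J y = 2 * J h + 2 * Re (ip (D w) w)"
      using J_expand[OF h w] J_expand[OF h w'] w h D by (simp add: D_smult f_smult)
    moreover have "m * (nrm w)\<^sup>2 \<le> Re (ip (D w) w)" by (rule m(2)[OF w])
    moreover have "nrm w = nrm (x \<ominus> y) / 2" using x y by (simp add: w_def nrm_smult)
    ultimately show ?thesis using d_le[OF h] by (simp add: power2_eq_square)
  qed
  have "\<exists>L\<in>C. (\<lambda>n. nrm (X n \<ominus> L)) \<longlonglongrightarrow> 0"
  proof (rule complete)
    fix e :: real assume e: "e > 0"
    \<comment> \<open>Two late members of the sequence exceed \<open>2 * d\<close> together by less
      than \<open>2 / Suc N\<close>, hence by less than \<open>m / 2 * e\<^sup>2\<close>, which is
      the scale of \<open>par\<close>.\<close>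
    obtain N where N: "inverse (real (Suc N)) < m / 4 * e\<^sup>2"
      using reals_Archimedean[of "m / 4 * e\<^sup>2"] m(1) e by auto
    have "nrm (X k \<ominus> X l) < e" if "k \<ge> N" "l \<ge> N" for k l
    proof -
      have "inverse (real (Suc k)) \<le> inverse (real (Suc N))"
        "inverse (real (Suc l)) \<le> inverse (real (Suc N))"
        using that by (auto intro!: le_imp_inverse_le)
      then have "m / 2 * (nrm (X k \<ominus> X l))\<^sup>2 < m / 2 * e\<^sup>2"
        using par[OF X(1) X(1), of k l] X(2)[of k] X(2)[of l] N by linarith
      then have "(nrm (X k \<ominus> X l))\<^sup>2 < e\<^sup>2" using m(1) by simp
      then show ?thesis using e by (meson less_imp_le power_less_imp_less_base)
    qed
    then show "\<exists>N. \<forall>k\<ge>N. \<forall>l\<ge>N. nrm (X k \<ominus> X l) < e" by blast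
  qed (use X in auto)
  then obtain z where z: "z \<in> C" and lim: "(\<lambda>n. nrm (X n \<ominus> z)) \<longlonglongrightarrow> 0" by blast
  have "J z \<le> d"
  proof (rule LIMSEQ_le_const)
    have J_X: "J z \<le> J (X n) + 2 * (B * nrm z + K) * nrm (X n \<ominus> z)" for n
    proof -
      define w where "w = X n \<ominus> z"
      have w: "w \<in> C" and Xn: "X n \<in> C" using X z by (auto simp: w_def)
      have "X n = z \<oplus> w" by (rule ip_eqI) (use z Xn in \<open>auto simp: w_def\<close>)
      then have "J (X n) = J z + Re (ip (D w) w) + 2 * (Re (ip w (D z)) - Re (\<phi> w))"
        using J_expand[OF z w] by simp
      moreover have "0 \<le> Re (ip (D w) w)"
        using m(2)[OF w] m(1) by (smt (verit) mult_nonneg_nonneg zero_le_power2)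
      moreover have "\<bar>Re (ip w (D z))\<bar> \<le> nrm w * (B * nrm z)"
        using Re_ip_le[OF w D[OF z]] mult_left_mono[OF D_bound[OF z] nrm_nonneg[OF w]] by linarith
      moreover have "\<bar>Re (\<phi> w)\<bar> \<le> K * nrm w"
        using f_bound[OF w] abs_Re_le_cmod[of "\<phi> w"] by linarith
      ultimately show ?thesis by (simp add: w_def[symmetric] algebra_simps)
    qed
    then show "\<exists>N. \<forall>n\<ge>N. J z \<le> d + inverse (real (Suc n)) + 2 * (B * nrm z + K) * nrm (X n \<ominus> z)"
      using X(2) J_X by (intro exI[of _ 0] allI impI) (smt (verit))
    show "(\<lambda>n. d + inverse (real (Suc n)) + 2 * (B * nrm z + K) * nrm (X n \<ominus> z)) \<longlonglongrightarrow> d"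
      using tendsto_add[OF tendsto_add[OF tendsto_const[of d] LIMSEQ_inverse_real_of_nat]
          tendsto_mult[OF tendsto_const[of "2 * (B * nrm z + K)"] lim]] by simp
  qed
  then have crit: "0 \<le> Re (ip (D w) w) + 2 * (Re (ip w (D z)) - Re (\<phi> w))" if "w \<in> C" for w
    using d_le[of "z \<oplus> w"] J_expand[OF z that] z that by simp
  have Re_eq: "Re (\<phi> w) = Re (ip w (D z))" if w: "w \<in> C" for w
  proof (rule ccontr)
    define b where "b = Re (ip w (D z)) - Re (\<phi> w)"
    define a where "a = Re (ip (D w) w)"
    assume "Re (\<phi> w) \<noteq> Re (ip w (D z))"
    then have b: "b \<noteq> 0" by (simp add: b_def)
    have a: "a \<ge> 0"
      using m(2)[OF w] m(1) by (smt (verit) a_def mult_nonneg_nonneg zero_le_power2)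
    then have a1: "a + 1 \<noteq> 0" by simp
    have *: "0 \<le> t\<^sup>2 * a + 2 * t * b" for t
      using crit[of "complex_of_real t \<odot> w"] w z D
      by (simp add: D_smult f_smult a_def b_def power2_eq_square algebra_simps)
    \<comment> \<open>For \<open>a > 0\<close> the parabola is minimal at \<open>-b / a\<close>; the
      denominator \<open>a + 1\<close> also covers \<open>a = 0\<close> and still yields a negative
      value.\<close>
    have "0 \<le> (- b / (a + 1))\<^sup>2 * a + 2 * (- b / (a + 1)) * b" by (rule *)
    also have "\<dots> = - b\<^sup>2 * (a + 2) / (a + 1)\<^sup>2"
      using a1 by (simp add: divide_simps) (simp add: algebra_simps power2_eq_square)
    also have "\<dots> < 0" using a b by (simp add: divide_neg_pos mult_neg_pos)
    finally show False by simp
  qed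
  \<comment> \<open>The imaginary parts come from the real parts at
    \<open>\<i> \<odot> w\<close>.\<close>
  have "\<phi> w = ip w (D z)" if w: "w \<in> C" for w
    using Re_eq[OF w] Re_eq[of "\<i> \<odot> w"] w z D by (simp add: f_smult complex_eq_iff)
  then show ?thesis using z by blast
qed

end

section \<open>Bounded operators and polynomials of an operator\<close>

lemma bounded_ops_in: "T \<in> bounded_ops V W \<Longrightarrow> x \<in> carrier V \<Longrightarrow> T x \<in> carrier W"
  by (auto simp: bounded_ops_def module_hom_def)

lemma bounded_ops_add:
  "T \<in> bounded_ops V W \<Longrightarrow> x \<in> carrier V \<Longrightarrow> y \<in> carrier V \<Longrightarrow>
    T (x \<oplus>\<^bsub>V\<^esub> y) = T x \<oplus>\<^bsub>W\<^esub> T y"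
  by (auto simp: bounded_ops_def module_hom_def)

lemma bounded_ops_smult:
  "T \<in> bounded_ops V W \<Longrightarrow> x \<in> carrier V \<Longrightarrow> T (c \<odot>\<^bsub>V\<^esub> x) = c \<odot>\<^bsub>W\<^esub> T x"
  by (auto simp: bounded_ops_def module_hom_def)

lemma bounded_ops_eqI:
  assumes "T \<in> bounded_ops V W" "R \<in> bounded_ops V W" "\<And>x. x \<in> carrier V \<Longrightarrow> T x = R x"
  shows "T = R"
  using assms by (auto simp: bounded_ops_def intro: extensionalityI)

lemma hilbert_spaceI: "complex_hilbert V \<Longrightarrow> hilbert_space V"
  by (simp add: hilbert_space_def)

lemma bounded_ops_bound:
  assumes "complex_hilbert V" "T \<in> bounded_ops V W"
  obtains c where "c \<ge> 0" "\<And>x. x \<in> carrier V \<Longrightarrow> hnorm W (T x) \<le> c * hnorm V x"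
proof -
  interpret hilbert_space V by (rule hilbert_spaceI) fact
  obtain c where c: "\<And>x. x \<in> carrier V \<Longrightarrow> hnorm W (T x) \<le> c * hnorm V x"
    using assms(2) by (auto simp: bounded_ops_def)
  have "hnorm W (T x) \<le> \<bar>c\<bar> * hnorm V x" if "x \<in> carrier V" for x
    using c[OF that] mult_right_mono[OF abs_ge_self nrm_nonneg[OF that], of c] by linarith
  then show ?thesis by (rule that[rotated]) simp_all
qed

lemma op_norm_nonneg_bound:
  assumes "complex_hilbert V" "complex_hilbert W" "T \<in> bounded_ops V W"
  shows op_norm_nonneg: "0 \<le> op_norm V W T"
    and op_norm_bound: "x \<in> carrier V \<Longrightarrow> hnorm W (T x) \<le> op_norm V W T * hnorm V x"
proof -
  interpret V: hilbert_space V by (rule hilbert_spaceI) fact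
  interpret W: hilbert_space W by (rule hilbert_spaceI) fact
  let ?S = "{hnorm W (T x) | x. x \<in> carrier V \<and> hnorm V x \<le> 1}"
  obtain c where c: "c \<ge> 0" "\<And>x. x \<in> carrier V \<Longrightarrow> hnorm W (T x) \<le> c * hnorm V x"
    using bounded_ops_bound[OF assms(1,3)] by blast
  have bdd: "bdd_above ?S"
  proof (rule bdd_aboveI)
    fix r assume "r \<in> ?S"
    then obtain x where x: "x \<in> carrier V" "hnorm V x \<le> 1" "r = hnorm W (T x)" by blast
    show "r \<le> c" using c(2)[OF x(1)] mult_left_mono[OF x(2) c(1)] x(3) by simp
  qed
  have up: "hnorm W (T x) \<le> op_norm V W T" if "x \<in> carrier V" "hnorm V x \<le> 1" for x
    unfolding op_norm_def by (rule cSup_upper[OF _ bdd]) (use that in blast)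
  have "0 \<le> hnorm W (T \<zero>\<^bsub>V\<^esub>)" by (intro W.nrm_nonneg bounded_ops_in[OF assms(3)]) simp
  also have "\<dots> \<le> op_norm V W T" by (rule up) simp_all
  finally show nn: "0 \<le> op_norm V W T" .
  show "hnorm W (T x) \<le> op_norm V W T * hnorm V x" if x: "x \<in> carrier V"
  proof (cases "hnorm V x = 0")
    case True
    then show ?thesis using c(2)[OF x] by simp
  next
    case False
    then have pos: "hnorm V x > 0" using V.nrm_nonneg[OF x] by linarith
    define t where "t = complex_of_real (inverse (hnorm V x))"
    have "hnorm W (T (t \<odot>\<^bsub>V\<^esub> x)) \<le> op_norm V W T"
      by (rule up) (use pos x in \<open>simp_all add: V.nrm_smult t_def norm_inverse\<close>)
    then show ?thesis
      using pos x bounded_ops_in[OF assms(3) x]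
      by (simp add: bounded_ops_smult[OF assms(3)] W.nrm_smult t_def norm_inverse)
        (simp add: field_simps)
  qed
qed

lemma op_norm_le:
  assumes "complex_hilbert V" "K \<ge> 0"
    and "\<And>x. x \<in> carrier V \<Longrightarrow> hnorm W (T x) \<le> K * hnorm V x"
  shows "op_norm V W T \<le> K"
  unfolding op_norm_def
proof (rule cSup_least)
  interpret V: hilbert_space V by (rule hilbert_spaceI) fact
  have "hnorm W (T \<zero>\<^bsub>V\<^esub>) \<in> {hnorm W (T x) | x. x \<in> carrier V \<and> hnorm V x \<le> 1}"
    by (intro CollectI exI[of _ "\<zero>\<^bsub>V\<^esub>"]) simp
  then show "{hnorm W (T x) | x. x \<in> carrier V \<and> hnorm V x \<le> 1} \<noteq> {}" by blast
  fix r assume "r \<in> {hnorm W (T x) | x. x \<in> carrier V \<and> hnorm V x \<le> 1}"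
  then obtain x where x: "x \<in> carrier V" "hnorm V x \<le> 1" "r = hnorm W (T x)" by blast
  show "r \<le> K" using assms(3)[OF x(1)] mult_left_mono[OF x(2) assms(2)] x(3) by simp
qed

section \<open>Polynomials of an operator\<close>

lemma map_poly_of_real_mult:
  "map_poly complex_of_real (p * q) = map_poly complex_of_real p * map_poly complex_of_real q"
  by (rule poly_eqI) (simp add: coeff_map_poly coeff_mult)

lemma map_poly_of_real_add:
  "map_poly complex_of_real (p + q) = map_poly complex_of_real p + map_poly complex_of_real q"
  by (rule poly_eqI) (simp add: coeff_map_poly)

lemma map_poly_of_real_diff:
  "map_poly complex_of_real (p - q) = map_poly complex_of_real p - map_poly complex_of_real q"
  by (rule poly_eqI) (simp add: coeff_map_poly)

lemma poly_map_poly_of_real: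
  "poly (map_poly complex_of_real p) (complex_of_real t) = complex_of_real (poly p t)"
  by (induction p) (simp_all add: map_poly_pCons)

context hilbert_space
begin

abbreviation B :: "('a \<Rightarrow> 'a) set" where "B \<equiv> bounded_ops V V"

lemma complex_hilbert: "complex_hilbert V" ..

lemmas B_in = bounded_ops_in[of _ V V]
lemmas B_add = bounded_ops_add[of _ V V]
lemmas B_smult = bounded_ops_smult[of _ V V]
lemmas B_bound = bounded_ops_bound[OF complex_hilbert, of _ V]

lemma smult_zero [simp]: "x \<in> C \<Longrightarrow> 0 \<odot> x = \<zero>"
  using module.smult_l_null[of x] by simp

lemma smult_one_left [simp]: "x \<in> C \<Longrightarrow> 1 \<odot> x = x"
  using module.smult_one[of x] by simp

lemma B_zero: "T \<in> B \<Longrightarrow> T \<zero> = \<zero>"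
  using B_smult[of T \<zero> 0] B_in[of T \<zero>] by simp

lemma B_minus: "T \<in> B \<Longrightarrow> x \<in> C \<Longrightarrow> y \<in> C \<Longrightarrow> T (x \<ominus> y) = T x \<ominus> T y"
  by (simp add: minus_eq_smult B_add B_smult B_in)

lemma BI:
  assumes "\<And>x. x \<in> C \<Longrightarrow> F x \<in> C"
    and "\<And>x y. x \<in> C \<Longrightarrow> y \<in> C \<Longrightarrow> F (x \<oplus> y) = F x \<oplus> F y"
    and "\<And>c x. x \<in> C \<Longrightarrow> F (c \<odot> x) = c \<odot> F x"
    and "\<And>x. x \<in> C \<Longrightarrow> nrm (F x) \<le> K * nrm x"
  shows "(\<lambda>x\<in>C. F x) \<in> B"
  using assms by (auto simp: bounded_ops_def module_hom_def intro: exI[of _ K])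

definition cpoly :: "('a \<Rightarrow> 'a) \<Rightarrow> complex poly \<Rightarrow> 'a \<Rightarrow> 'a" where
  "cpoly T p x = fold_coeffs (\<lambda>a v. a \<odot> x \<oplus> T v) p \<zero>"

context
  fixes T assumes T: "T \<in> B"
begin

lemmas T_simps = T B_in[OF T] B_zero[OF T]

lemma cpoly_0 [simp]: "cpoly T 0 x = \<zero>"
  by (simp add: cpoly_def)

lemma cpoly_pCons: "x \<in> C \<Longrightarrow> cpoly T (pCons a p) x = a \<odot> x \<oplus> T (cpoly T p x)"
  by (cases "p = 0"; cases "a = 0")
     (simp_all add: cpoly_def T_simps fold_coeffs_pCons_coeff_not_0_eq fold_coeffs_pCons_not_0_0_eq)

lemma cpoly_in [simp]: "x \<in> C \<Longrightarrow> cpoly T p x \<in> C"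
  by (induction p) (simp_all add: cpoly_pCons T_simps)

lemma cpoly_const [simp]: "x \<in> C \<Longrightarrow> cpoly T [:a:] x = a \<odot> x"
  by (simp add: cpoly_pCons T_simps)

lemma cpoly_plus: "x \<in> C \<Longrightarrow> cpoly T (p + q) x = cpoly T p x \<oplus> cpoly T q x"
proof (induction p q rule: poly_induct2)
  case (pCons a p b q)
  then show ?case
    by (intro ip_eqI) (simp_all add: cpoly_pCons T_simps B_add algebra_simps)
qed simp

lemma cpoly_smult_poly: "x \<in> C \<Longrightarrow> cpoly T (Polynomial.smult c p) x = c \<odot> cpoly T p x"
proof (induction p)
  case (pCons a p)
  then show ?case
    by (intro ip_eqI) (simp_all add: cpoly_pCons T_simps B_smult algebra_simps)
qed simp

lemma cpoly_mult: "x \<in> C \<Longrightarrow> cpoly T (p * q) x = cpoly T p (cpoly T q x)"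
proof (induction p)
  case (pCons a p)
  then show ?case
    by (simp add: cpoly_pCons T_simps cpoly_plus cpoly_smult_poly)
qed simp

lemma cpoly_minus: "x \<in> C \<Longrightarrow> cpoly T (p - q) x = cpoly T p x \<ominus> cpoly T q x"
  using cpoly_plus[of x p "Polynomial.smult (-1) q"] cpoly_smult_poly[of x "-1" q]
  by (simp add: minus_eq_smult)

lemma cpoly_vadd: "x \<in> C \<Longrightarrow> y \<in> C \<Longrightarrow> cpoly T p (x \<oplus> y) = cpoly T p x \<oplus> cpoly T p y"
proof (induction p)
  case (pCons a p)
  then show ?case
    by (intro ip_eqI) (simp_all add: cpoly_pCons T_simps B_add algebra_simps)
qed simp

lemma cpoly_vsmult: "x \<in> C \<Longrightarrow> cpoly T p (c \<odot> x) = c \<odot> cpoly T p x"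
proof (induction p)
  case (pCons a p)
  then show ?case
    by (intro ip_eqI) (simp_all add: cpoly_pCons T_simps B_smult algebra_simps)
qed simp

lemma cpoly_commute: "x \<in> C \<Longrightarrow> cpoly T p (T x) = T (cpoly T p x)"
proof (induction p)
  case (pCons a p)
  then show ?case
    by (simp add: cpoly_pCons T_simps B_add B_smult)
qed (simp add: T_simps)

lemma cpoly_bound: "\<exists>c. \<forall>x\<in>C. nrm (cpoly T p x) \<le> c * nrm x"
proof (induction p)
  case 0
  show ?case by (intro exI[of _ 0]) simp
next
  case (pCons a p)
  obtain c where c: "\<And>x. x \<in> C \<Longrightarrow> nrm (cpoly T p x) \<le> c * nrm x" using pCons by blast
  obtain d where d: "d \<ge> 0" "\<And>x. x \<in> C \<Longrightarrow> nrm (T x) \<le> d * nrm x" using B_bound[OF T] by blast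
  have "nrm (cpoly T (pCons a p) x) \<le> (cmod a + d * c) * nrm x" if x: "x \<in> C" for x
  proof -
    have "nrm (cpoly T (pCons a p) x) \<le> nrm (a \<odot> x) + nrm (T (cpoly T p x))"
      using x by (simp add: cpoly_pCons nrm_triangle T_simps)
    also have "\<dots> \<le> cmod a * nrm x + d * (c * nrm x)"
      using d(2)[of "cpoly T p x"] mult_left_mono[OF c[OF x] d(1)] x by (simp add: nrm_smult)
    finally show ?thesis by (simp add: algebra_simps)
  qed
  then show ?case by blast
qed

lemma cpoly_B: "(\<lambda>x\<in>C. cpoly T p x) \<in> B"
proof -
  obtain c where "\<forall>x\<in>C. nrm (cpoly T p x) \<le> c * nrm x" using cpoly_bound by blast
  then show ?thesis by (intro BI[where K = c]) (simp_all add: cpoly_vadd cpoly_vsmult)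
qed

lemma T_finsum:
  assumes "\<And>k. g k \<in> C"
  shows "T (finsum V g {..n::nat}) = finsum V (\<lambda>k. T (g k)) {..n}"
proof (induction n)
  case 0
  have "g \<in> {0} \<rightarrow> C" "(\<lambda>k. T (g k)) \<in> {0} \<rightarrow> C" using assms B_in[OF T] by auto
  then show ?case by (simp only: module.M.finsum_0)
next
  case (Suc n)
  have 1: "g \<in> {..Suc n} \<rightarrow> C" "(\<lambda>k. T (g k)) \<in> {..Suc n} \<rightarrow> C" using assms B_in[OF T] by auto
  have "g \<in> {..n} \<rightarrow> C" using assms by auto
  then have "finsum V g {..n} \<in> C" by (rule module.M.finsum_closed)
  then show ?case
    by (simp only: module.M.finsum_Suc[OF 1(1)] module.M.finsum_Suc[OF 1(2)] B_add[OF T] assms Suc.IH)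
qed

text \<open>The upper limit n may exceed the degree: splitting off the power 0 lowers it by exactly
  one, whereas \<open>p\<close> and \<open>pCons a p\<close> have the same degree when
  \<open>p = 0\<close>.\<close>

lemma finsum_eq_cpoly:
  "x \<in> C \<Longrightarrow> degree p \<le> n \<Longrightarrow>
    finsum V (\<lambda>k. coeff p k \<odot> (T ^^ k) x) {..n} = cpoly T p x"
proof (induction p arbitrary: n)
  case 0
  have "finsum V (\<lambda>k. \<zero>) {..n} = \<zero>" by simp
  moreover have pow: "(T ^^ k) x \<in> C" for k by (induction k) (simp_all add: T_simps 0)
  ultimately show ?case by simp
next
  case (pCons a p)
  have pow: "(T ^^ k) x \<in> C" for k by (induction k) (simp_all add: T_simps pCons)
  show ?case
  proof (cases n)
    case 0
    then have "p = 0" using pCons.prems by (auto split: if_splits)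
    then show ?thesis using 0 pCons.prems by (simp add: cpoly_pCons T_simps)
  next
    case (Suc m)
    have deg: "degree p \<le> m" using pCons.prems Suc by (auto split: if_splits)
    have "finsum V (\<lambda>k. coeff (pCons a p) k \<odot> (T ^^ k) x) {..Suc m}
        = finsum V (\<lambda>k. coeff p k \<odot> (T ^^ Suc k) x) {..m} \<oplus> a \<odot> x"
      by (subst module.M.finsum_Suc2) (use pow pCons.prems in \<open>auto simp: T_simps\<close>)
    also have "finsum V (\<lambda>k. coeff p k \<odot> (T ^^ Suc k) x) {..m} = T (cpoly T p x)"
      using pow pCons.prems
      by (simp add: T_simps B_smult T_finsum flip: pCons.IH[OF _ deg])
    also have "T (cpoly T p x) \<oplus> a \<odot> x = cpoly T (pCons a p) x"
      using pCons.prems by (simp add: cpoly_pCons module.M.a_comm T_simps)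
    finally show ?thesis using Suc by simp
  qed
qed

lemma op_poly_eq: "x \<in> C \<Longrightarrow> op_poly V p T x = cpoly T (map_poly complex_of_real p) x"
  using finsum_eq_cpoly[of x "map_poly complex_of_real p" "degree p"]
  by (simp add: op_poly_def coeff_map_poly degree_le coeff_eq_0)

lemma op_poly_B: "op_poly V p T \<in> B"
proof -
  have "op_poly V p T = (\<lambda>x\<in>C. cpoly T (map_poly complex_of_real p) x)"
    by (rule ext) (use op_poly_eq in \<open>auto simp: op_poly_def restrict_def\<close>)
  then show ?thesis by (simp add: cpoly_B)
qed

lemma op_poly_pCons:
  "x \<in> C \<Longrightarrow> op_poly V (pCons a p) T x = complex_of_real a \<odot> x \<oplus> T (op_poly V p T x)"
  by (simp add: op_poly_eq map_poly_pCons cpoly_pCons)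

lemma op_poly_0: "x \<in> C \<Longrightarrow> op_poly V 0 T x = \<zero>"
  by (simp add: op_poly_eq)

lemma op_poly_const: "x \<in> C \<Longrightarrow> op_poly V [:a:] T x = complex_of_real a \<odot> x"
  by (simp add: op_poly_pCons op_poly_0 T_simps)

lemma op_poly_mult: "x \<in> C \<Longrightarrow> op_poly V (p * q) T x = op_poly V p T (op_poly V q T x)"
  by (simp add: op_poly_eq map_poly_of_real_mult cpoly_mult)

lemma op_poly_add: "x \<in> C \<Longrightarrow> op_poly V (p + q) T x = op_poly V p T x \<oplus> op_poly V q T x"
  by (simp add: op_poly_eq map_poly_of_real_add cpoly_plus)

lemma op_poly_minus: "x \<in> C \<Longrightarrow> op_poly V (p - q) T x = op_poly V p T x \<ominus> op_poly V q T x"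
  by (simp add: op_poly_eq map_poly_of_real_diff cpoly_minus)

text \<open>Real coefficients cross the inner product unchanged. In the recursive term T reaches the
  second argument before p(T) does, hence the generalisation over y and the commutation of T with
  p(T).\<close>

lemma op_poly_selfadjoint:
  assumes self: "\<And>x y. x \<in> C \<Longrightarrow> y \<in> C \<Longrightarrow> ip (T x) y = ip x (T y)"
  shows "x \<in> C \<Longrightarrow> y \<in> C \<Longrightarrow> ip (op_poly V p T x) y = ip x (op_poly V p T y)"
proof (induction p arbitrary: y)
  case 0
  then show ?case by (simp add: op_poly_0)
next
  case (pCons a p)
  have in': "op_poly V p T z \<in> C" if "z \<in> C" for z by (rule B_in[OF op_poly_B that])
  have comm: "op_poly V p T (T z) = T (op_poly V p T z)" if "z \<in> C" for z
    using that by (simp add: op_poly_eq cpoly_commute T_simps)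
  show ?case using pCons by (simp add: op_poly_pCons in' comm self T_simps)
qed

end

section \<open>Spectrum and norm of a polynomial of a self-adjoint operator\<close>

lemma bounded_below_notin_spectrum:
  assumes T: "T \<in> B" and l: "l \<notin> op_spectrum V T"
  shows "\<exists>c>0. \<forall>x\<in>C. c * nrm x \<le> nrm (l \<odot> x \<ominus> T x)"
proof -
  let ?D = "op_diff V V (\<lambda>x\<in>C. l \<odot> x) T"
  obtain R where R: "R \<in> B" "compose C R ?D = (\<lambda>x\<in>C. x)"
    using l by (auto simp: op_spectrum_def Let_def)
  obtain d where d: "d \<ge> 0" "\<And>x. x \<in> C \<Longrightarrow> nrm (R x) \<le> d * nrm x" using B_bound[OF R(1)] by blast
  \<comment> \<open>A left inverse bounded by d gives the lower bound 1/d; \<open>d + 1\<close>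
    avoids a division by 0.\<close>
  have "inverse (d + 1) * nrm x \<le> nrm (l \<odot> x \<ominus> T x)" if x: "x \<in> C" for x
  proof -
    have "R (l \<odot> x \<ominus> T x) = x"
      using fun_cong[OF R(2), of x] x by (simp add: compose_def op_diff_def)
    then have "nrm x \<le> d * nrm (l \<odot> x \<ominus> T x)" using d(2)[of "l \<odot> x \<ominus> T x"] x B_in[OF T] by simp
    also have "\<dots> \<le> (d + 1) * nrm (l \<odot> x \<ominus> T x)" using x B_in[OF T] by (simp add: algebra_simps)
    finally show ?thesis using d(1) by (simp add: field_simps)
  qed
  then show ?thesis using d(1) by (intro exI[of _ "inverse (d + 1)"]) simp
qed

text \<open>The number \<open>\<langle>T x, x\<rangle>\<close> is real, so the form of l - T has
  imaginary part \<open>Im l\<close> times the squared norm, and Cauchy--Schwarz applies. This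
  excludes nonreal roots in the norm estimate.\<close>

lemma bounded_below_nonreal:
  assumes T: "T \<in> B" and self: "\<And>x y. x \<in> C \<Longrightarrow> y \<in> C \<Longrightarrow> ip (T x) y = ip x (T y)"
    and x: "x \<in> C"
  shows "\<bar>Im l\<bar> * nrm x \<le> nrm (l \<odot> x \<ominus> T x)"
proof (cases "nrm x = 0")
  case True
  then show ?thesis using x B_in[OF T] by simp
next
  case False
  then have pos: "nrm x > 0" using nrm_nonneg[OF x] by linarith
  have "ip (T x) x = cnj (ip (T x) x)"
    using self[OF x x] cinner_commute[of "T x" x] x B_in[OF T] by simp
  then have "Im (ip (T x) x) = 0" by (simp add: complex_eq_iff)
  then have "Im (ip (l \<odot> x \<ominus> T x) x) = Im l * (nrm x)\<^sup>2"
    using x B_in[OF T] by (simp add: ip_self flip: of_real_power)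
  then have "\<bar>Im l\<bar> * (nrm x)\<^sup>2 \<le> nrm (l \<odot> x \<ominus> T x) * nrm x"
    using abs_Im_le_cmod[of "ip (l \<odot> x \<ominus> T x) x"] cauchy_schwarz[of "l \<odot> x \<ominus> T x" x] x B_in[OF T]
    by (simp add: abs_mult)
  then show ?thesis using pos by (simp add: power2_eq_square)
qed

text \<open>By the fundamental theorem of algebra p(T) is, up to a nonzero scalar, a composition of
  factors T - l, and lower bounds multiply under composition.\<close>

lemma cpoly_bounded_below:
  assumes T: "T \<in> B" and p: "p \<noteq> 0"
    and root: "\<And>l. poly p l = 0 \<Longrightarrow> \<exists>c>0. \<forall>x\<in>C. c * nrm x \<le> nrm (l \<odot> x \<ominus> T x)"
  shows "\<exists>c>0. \<forall>x\<in>C. c * nrm x \<le> nrm (cpoly T p x)"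
  using p root
proof (induction "degree p" arbitrary: p)
  case 0
  then obtain a where a: "p = [:a:]" "a \<noteq> 0" by (metis degree_eq_zeroE pCons_0_0)
  then show ?case using T by (intro exI[of _ "cmod a"]) (simp add: nrm_smult)
next
  case (Suc n)
  have "\<not> constant (poly p)" using Suc.hyps(2) by (simp add: constant_degree)
  then obtain l where l: "poly p l = 0" using fundamental_theorem_of_algebra by blast
  then obtain q where q: "p = [:- l, 1:] * q" by (metis dvdE poly_eq_0_iff_dvd)
  have q0: "q \<noteq> 0" using Suc.prems(1) q by auto
  have "degree p = degree [:- l, 1:] + degree q" unfolding q by (rule degree_mult_eq) (use q0 in auto)
  then have "n = degree q" using Suc.hyps(2) by simp
  moreover have "\<exists>c>0. \<forall>x\<in>C. c * nrm x \<le> nrm (k \<odot> x \<ominus> T x)" if "poly q k = 0" for k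
    using Suc.prems(2)[of k] that q by simp
  ultimately obtain c where c: "c > 0" "\<And>x. x \<in> C \<Longrightarrow> c * nrm x \<le> nrm (cpoly T q x)"
    using Suc.hyps(1) q0 by blast
  obtain d where d: "d > 0" "\<And>x. x \<in> C \<Longrightarrow> d * nrm x \<le> nrm (l \<odot> x \<ominus> T x)"
    using Suc.prems(2)[OF l] by blast
  have "d * c * nrm x \<le> nrm (cpoly T p x)" if x: "x \<in> C" for x
  proof -
    define y where "y = cpoly T q x"
    have y: "y \<in> C" using x T by (simp add: y_def)
    have "cpoly T p x = T y \<ominus> l \<odot> y"
      using x y T B_in[OF T y] B_zero[OF T] module.M.r_zero
      by (intro ip_eqI) (simp_all only: q cpoly_mult y_def[symmetric], simp_all add: cpoly_pCons algebra_simps)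
    then have "nrm (cpoly T p x) = nrm (l \<odot> y \<ominus> T y)"
      using y B_in[OF T y] nrm_minus_commute[of "T y" "l \<odot> y"] by simp
    moreover have "d * (c * nrm x) \<le> d * nrm y"
      using c(2)[OF x] d(1) by (simp add: y_def)
    ultimately show ?thesis using d(2)[OF y] by simp
  qed
  then show ?case using c(1) d(1) by (intro exI[of _ "d * c"]) simp
qed

text \<open>With \<open>a\<close> the norm of \<open>A = p(T)\<close>, the operator \<open>a\<^sup>2 - A\<^sup>2\<close> is not bounded below; factor
  \<open>a\<^sup>2 - p\<^sup>2\<close> over the complex numbers.\<close>

lemma norm_attained_at_root:
  fixes p :: "real poly"
  assumes T: "T \<in> B" and self: "\<And>x y. x \<in> C \<Longrightarrow> y \<in> C \<Longrightarrow> ip (T x) y = ip x (T y)"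
    and nontrivial: "x0 \<in> C" "nrm x0 \<noteq> 0"
    and q: "q = map_poly complex_of_real ([:(op_norm V V (op_poly V p T))\<^sup>2:] - p * p)" "q \<noteq> 0"
  shows "\<exists>l. poly q l = 0 \<and> \<not> (\<exists>c>0. \<forall>x\<in>C. c * nrm x \<le> nrm (l \<odot> x \<ominus> T x))"
proof (rule ccontr)
  assume neg: "\<not> ?thesis"
  define A where "A = op_poly V p T"
  have A: "A \<in> B" using op_poly_B[OF T] by (simp add: A_def)
  have A_self: "ip (A x) y = ip x (A y)" if "x \<in> C" "y \<in> C" for x y
    using op_poly_selfadjoint[OF T self] that by (simp add: A_def)
  define a where "a = op_norm V V A"
  have a0: "a \<ge> 0" using op_norm_nonneg[OF complex_hilbert complex_hilbert A] by (simp add: a_def)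
  have a: "nrm (A x) \<le> a * nrm x" if "x \<in> C" for x
    using op_norm_bound[OF complex_hilbert complex_hilbert A that] by (simp add: a_def)
  have qA: "cpoly T q x = complex_of_real (a\<^sup>2) \<odot> x \<ominus> A (A x)" if x: "x \<in> C" for x
    using x T B_in[OF op_poly_B[OF T]]
    by (simp add: q A_def a_def op_poly_minus op_poly_const op_poly_mult flip: op_poly_eq
        del: of_real_power)
  \<comment> \<open>The square expands into three terms; the last, the squared norm of
    \<open>A (A x)\<close>, is at most \<open>a\<^sup>2\<close> times that of \<open>A x\<close> and
    absorbs half of the middle one.\<close>
  have exp: "(nrm (cpoly T q x))\<^sup>2 \<le> a\<^sup>2 * (a\<^sup>2 * (nrm x)\<^sup>2 - (nrm (A x))\<^sup>2)" if x: "x \<in> C" for x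
  proof -
    have 1: "Re (ip x (A (A x))) = (nrm (A x))\<^sup>2"
      using A_self[of x "A x"] x B_in[OF A] by (simp add: nrm_sq)
    have "(nrm (cpoly T q x))\<^sup>2 = a\<^sup>2 * a\<^sup>2 * (nrm x)\<^sup>2 - 2 * a\<^sup>2 * (nrm (A x))\<^sup>2 + (nrm (A (A x)))\<^sup>2"
      using x B_in[OF A] 1 by (simp add: qA nrm_minus_sq nrm_smult power_mult_distrib del: of_real_power)
    moreover have "(nrm (A (A x)))\<^sup>2 \<le> (a * nrm (A x))\<^sup>2"
      using a[of "A x"] x B_in[OF A] by (intro power_mono) auto
    ultimately show ?thesis by (simp add: algebra_simps power_mult_distrib)
  qed
  obtain c where c: "c > 0" "\<And>x. x \<in> C \<Longrightarrow> c * nrm x \<le> nrm (cpoly T q x)"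
    using cpoly_bounded_below[OF T q(2)] neg by blast
  have lower: "c\<^sup>2 * (nrm x)\<^sup>2 \<le> a\<^sup>2 * (a\<^sup>2 * (nrm x)\<^sup>2 - (nrm (A x))\<^sup>2)" if x: "x \<in> C" for x
  proof -
    have "(c * nrm x)\<^sup>2 \<le> (nrm (cpoly T q x))\<^sup>2" using c x by (intro power_mono) auto
    then show ?thesis using exp[OF x] by (simp add: power_mult_distrib)
  qed
  \<comment> \<open>With \<open>a = 0\<close> the right side of \<open>lower\<close> vanishes, which
    the nonzero vector \<open>x0\<close> forbids.\<close>
  have apos: "a > 0"
  proof (rule ccontr)
    assume "\<not> a > 0"
    then have "c\<^sup>2 * (nrm x0)\<^sup>2 \<le> 0" using a0 lower[OF nontrivial(1)] by simp
    then show False using c(1) nontrivial(2) by (simp add: mult_le_0_iff)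
  qed
  \<comment> \<open>Dividing \<open>lower\<close> by \<open>a\<^sup>2\<close> bounds A by b, a
    number smaller than the norm a. The maximum with 0 guards against a difference that is negative
    as far as is known here.\<close>
  define b where "b = sqrt (max 0 (a\<^sup>2 - c\<^sup>2 / a\<^sup>2))"
  have "nrm (A x) \<le> b * nrm x" if x: "x \<in> C" for x
  proof (rule power2_le_imp_le)
    have "(nrm (A x))\<^sup>2 \<le> (a\<^sup>2 - c\<^sup>2 / a\<^sup>2) * (nrm x)\<^sup>2"
      using lower[OF x] apos by (simp add: field_simps)
    then show "(nrm (A x))\<^sup>2 \<le> (b * nrm x)\<^sup>2"
      using mult_right_mono[of "a\<^sup>2 - c\<^sup>2 / a\<^sup>2" "max 0 (a\<^sup>2 - c\<^sup>2 / a\<^sup>2)" "(nrm x)\<^sup>2"]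
      by (simp add: b_def power_mult_distrib)
  qed (use x in \<open>simp add: b_def\<close>)
  then have "a \<le> b" unfolding a_def by (intro op_norm_le complex_hilbert) (simp_all add: b_def)
  then have "a\<^sup>2 \<le> max 0 (a\<^sup>2 - c\<^sup>2 / a\<^sup>2)" using a0 power_mono[of a b 2] by (simp add: b_def)
  moreover have "c\<^sup>2 / a\<^sup>2 > 0" "a\<^sup>2 > 0" using c apos by auto
  ultimately show False by linarith
qed

text \<open>At the root l supplied by the previous lemma, l - T is not bounded below. Hence l is
  real and in the spectrum, and \<open>p(l)\<^sup>2 = a\<^sup>2\<close> with a the norm of p(T): the
  norm is a value of \<bar>p\<bar> on the spectrum.\<close>

lemma op_poly_norm_le:
  assumes T: "T \<in> B" and self: "\<And>x y. x \<in> C \<Longrightarrow> y \<in> C \<Longrightarrow> ip (T x) y = ip x (T y)"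
    and K: "K \<ge> 0" "\<And>t. complex_of_real t \<in> op_spectrum V T \<Longrightarrow> \<bar>poly p t\<bar> \<le> K"
    and x: "x \<in> C"
  shows "nrm (op_poly V p T x) \<le> K * nrm x"
proof (cases "nrm x = 0")
  case True
  then have "x = \<zero>" using x nrm_eq_0 by simp
  then show ?thesis using B_zero[OF op_poly_B[OF T]] by simp
next
  case False
  define a where "a = op_norm V V (op_poly V p T)"
  define q where "q = map_poly complex_of_real ([:a\<^sup>2:] - p * p)"
  let ?bb = "\<lambda>l. \<exists>c>0. \<forall>x\<in>C. c * nrm x \<le> nrm (l \<odot> x \<ominus> T x)"
  have a0: "a \<ge> 0"
    using op_norm_nonneg[OF complex_hilbert complex_hilbert op_poly_B[OF T]] by (simp add: a_def)
  obtain l where l: "poly q l = 0" "\<not> ?bb l"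
  proof (cases "q = 0")
    case True
    \<comment> \<open>Here p is constant and every number is a root of q, so any point where l - T
      is not bounded below will do. The identity polynomial supplies one, since its
      \<open>q'\<close> has leading coefficient -1.\<close>
    define q' where "q' = map_poly complex_of_real
      ([:(op_norm V V (op_poly V [:0, 1:] T))\<^sup>2:] - [:0, 1:] * [:0, 1:])"
    have "coeff q' 2 = -1" by (simp add: q'_def coeff_map_poly numeral_2_eq_2)
    then have "q' \<noteq> 0" by auto
    then show ?thesis
      using norm_attained_at_root[OF T self x False q'_def] that True by auto
  next
    case False': False
    then show ?thesis
      using norm_attained_at_root[OF T self x False q_def[unfolded a_def]] that
      by (auto simp: q_def a_def)
  qed
  have "Im l = 0"
  proof (rule ccontr)
    assume "Im l \<noteq> 0"
    then show False using l(2) bounded_below_nonreal[OF T self, of _ l]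
      by (metis zero_less_abs_iff)
  qed
  then obtain t where t: "l = complex_of_real t" by (metis complex_is_Real_iff Reals_cases)
  have "complex_of_real t \<in> op_spectrum V T"
    using bounded_below_notin_spectrum[OF T] l(2) t by blast
  then have "\<bar>poly p t\<bar> \<le> K" by (rule K(2))
  moreover have "\<bar>poly p t\<bar> = a"
  proof -
    have "a\<^sup>2 = (poly p t)\<^sup>2"
      using l(1) by (simp only: q_def t poly_map_poly_of_real of_real_eq_0_iff)
        (simp add: power2_eq_square)
    then show ?thesis using a0 by (auto simp: power2_eq_iff)
  qed
  ultimately have "a \<le> K" by simp
  then show ?thesis
    using op_norm_bound[OF complex_hilbert complex_hilbert op_poly_B[OF T] x, of p]
      mult_right_mono[of a K "nrm x"] x by (simp add: a_def)
qed

end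

section \<open>The continuous functional calculus of a positive operator\<close>

lemma le_by_epsilon:
  fixes a b c :: real
  assumes "\<And>e. e > 0 \<Longrightarrow> a \<le> b + c * e"
  shows "a \<le> b"
proof (rule ccontr)
  assume "\<not> a \<le> b"
  then have d: "a - b > 0" by simp
  define e where "e = (a - b) / (2 * (\<bar>c\<bar> + 1))"
  have e: "e > 0" using d by (simp add: e_def add_nonneg_pos)
  have "c * e \<le> (\<bar>c\<bar> + 1) * e" using e by (intro mult_right_mono) auto
  also have "\<dots> = (a - b) / 2" by (simp add: e_def add_nonneg_pos field_simps)
  finally show False using assms[OF e] d by simp
qed

lemma exists_poly_approx:
  fixes h :: "real \<Rightarrow> real"
  assumes "continuous_on {a..b} h" "e > 0"
  shows "\<exists>p. \<forall>t\<in>{a..b}. \<bar>poly p t - h t\<bar> \<le> e"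
proof -
  obtain g where g: "real_polynomial_function g" "\<And>t. t \<in> {a..b} \<Longrightarrow> \<bar>h t - g t\<bar> < e"
    using Stone_Weierstrass_real_polynomial_function[OF compact_Icc assms] by blast
  obtain c n where c: "g = (\<lambda>t. \<Sum>i\<le>n. c i * t ^ i)"
    using g(1) by (auto simp: real_polynomial_function_iff_sum)
  have "poly (\<Sum>i\<le>n. Polynomial.monom (c i) i) t = g t" for t
    by (simp add: c poly_sum poly_monom)
  then show ?thesis using g(2)
    by (intro exI[of _ "\<Sum>i\<le>n. Polynomial.monom (c i) i"]) (auto simp: abs_minus_commute less_imp_le)
qed

lemma continuous_on_interval_bound:
  fixes h :: "real \<Rightarrow> real"
  assumes "continuous_on {a..b} h"
  obtains K where "K \<ge> 0" "\<And>t. t \<in> {a..b} \<Longrightarrow> \<bar>h t\<bar> \<le> K"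
proof -
  have "bounded (h ` {a..b})"
    by (intro compact_imp_bounded compact_continuous_image assms compact_Icc)
  then obtain K where "\<And>t. t \<in> {a..b} \<Longrightarrow> \<bar>h t\<bar> \<le> K" unfolding bounded_iff by fastforce
  then show ?thesis using that[of "\<bar>K\<bar>"] by (meson abs_ge_self abs_ge_zero order_trans)
qed

context hilbert_space
begin

lemma eqI_nrm:
  assumes "x \<in> C" "y \<in> C" "nrm (x \<ominus> y) \<le> 0"
  shows "x = y"
proof -
  have "nrm (x \<ominus> y) = 0" using assms nrm_nonneg[of "x \<ominus> y"] by (intro antisym) simp_all
  then show ?thesis using assms by (simp add: nrm_eq_0 minus_eq_zero_iff)
qed

lemma ip_eqI_right:
  assumes "x \<in> C" "y \<in> C" "\<And>z. z \<in> C \<Longrightarrow> ip z x = ip z y"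
  shows "x = y"
  by (rule ip_eqI) (use assms cinner_commute in metis)+

lemma op_diff_B:
  assumes "T \<in> B" "R \<in> B"
  shows "op_diff V V T R \<in> B"
proof -
  obtain c where c: "\<And>x. x \<in> C \<Longrightarrow> nrm (T x) \<le> c * nrm x" using B_bound[OF assms(1)] by blast
  obtain d where d: "\<And>x. x \<in> C \<Longrightarrow> nrm (R x) \<le> d * nrm x" using B_bound[OF assms(2)] by blast
  note [simp] = B_in[OF assms(1)] B_in[OF assms(2)]
  show ?thesis unfolding op_diff_def
  proof (rule BI)
    fix x assume x: "x \<in> C"
    show "nrm (T x \<ominus> R x) \<le> (c + d) * nrm x"
      using nrm_triangle_minus[of "T x" "R x"] c[OF x] d[OF x] x by (simp add: algebra_simps)
  next
    fix x y assume xy: "x \<in> C" "y \<in> C"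
    then show "T (x \<oplus> y) \<ominus> R (x \<oplus> y) = (T x \<ominus> R x) \<oplus> (T y \<ominus> R y)"
      by (intro ip_eqI) (simp_all add: B_add[OF assms(1)] B_add[OF assms(2)])
  next
    fix c x assume x: "x \<in> C"
    then show "T (c \<odot> x) \<ominus> R (c \<odot> x) = c \<odot> (T x \<ominus> R x)"
      by (intro ip_eqI) (simp_all add: B_smult[OF assms(1)] B_smult[OF assms(2)] algebra_simps)
  qed simp
qed

lemma op_add_B:
  assumes "T \<in> B" "R \<in> B"
  shows "op_add V V T R \<in> B"
proof -
  obtain c where c: "\<And>x. x \<in> C \<Longrightarrow> nrm (T x) \<le> c * nrm x" using B_bound[OF assms(1)] by blast
  obtain d where d: "\<And>x. x \<in> C \<Longrightarrow> nrm (R x) \<le> d * nrm x" using B_bound[OF assms(2)] by blast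
  note [simp] = B_in[OF assms(1)] B_in[OF assms(2)]
  show ?thesis unfolding op_add_def
  proof (rule BI)
    fix x assume x: "x \<in> C"
    show "nrm (T x \<oplus> R x) \<le> (c + d) * nrm x"
      using nrm_triangle[of "T x" "R x"] c[OF x] d[OF x] x by (simp add: algebra_simps)
  next
    fix x y assume xy: "x \<in> C" "y \<in> C"
    then show "T (x \<oplus> y) \<oplus> R (x \<oplus> y) = (T x \<oplus> R x) \<oplus> (T y \<oplus> R y)"
      by (intro ip_eqI) (simp_all add: B_add[OF assms(1)] B_add[OF assms(2)])
  next
    fix c x assume x: "x \<in> C"
    then show "T (c \<odot> x) \<oplus> R (c \<odot> x) = c \<odot> (T x \<oplus> R x)"
      by (intro ip_eqI) (simp_all add: B_smult[OF assms(1)] B_smult[OF assms(2)] algebra_simps)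
  qed simp
qed

lemma compose_B:
  assumes "T \<in> B" "R \<in> B"
  shows "compose C T R \<in> B"
proof -
  obtain c where c: "c \<ge> 0" "\<And>x. x \<in> C \<Longrightarrow> nrm (T x) \<le> c * nrm x" using B_bound[OF assms(1)] by blast
  obtain d where d: "\<And>x. x \<in> C \<Longrightarrow> nrm (R x) \<le> d * nrm x" using B_bound[OF assms(2)] by blast
  note [simp] = B_in[OF assms(1)] B_in[OF assms(2)]
  show ?thesis unfolding compose_def
  proof (rule BI)
    fix x assume x: "x \<in> C"
    show "nrm (T (R x)) \<le> (c * d) * nrm x"
      using c(2)[of "R x"] mult_left_mono[OF d[OF x] c(1)] x by (simp add: algebra_simps)
  next
    fix x y assume xy: "x \<in> C" "y \<in> C"
    then show "T (R (x \<oplus> y)) = T (R x) \<oplus> T (R y)"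
      by (simp add: B_add[OF assms(1)] B_add[OF assms(2)])
  next
    fix c x assume x: "x \<in> C"
    then show "T (R (c \<odot> x)) = c \<odot> T (R x)"
      by (simp add: B_smult[OF assms(1)] B_smult[OF assms(2)])
  qed simp
qed

lemma scalar_B: "(\<lambda>x\<in>C. l \<odot> x) \<in> B"
proof (rule BI)
  fix x y assume xy: "x \<in> C" "y \<in> C"
  then show "l \<odot> (x \<oplus> y) = l \<odot> x \<oplus> l \<odot> y"
    by (intro ip_eqI) (simp_all add: algebra_simps)
next
  fix c x assume x: "x \<in> C"
  then show "l \<odot> (c \<odot> x) = c \<odot> (l \<odot> x)"
    by (intro ip_eqI) (simp_all add: algebra_simps)
next
  fix x assume "x \<in> C" then show "nrm (l \<odot> x) \<le> cmod l * nrm x" by (simp add: nrm_smult)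
qed simp

text \<open>The real factor e treats positive and negative definite D alike, because e D is
  coercive. Lax--Milgram gives surjectivity; Cauchy--Schwarz gives the lower bound that makes the
  inverse unique and bounded.\<close>

lemma coercive_invertible:
  fixes e :: real
  assumes D: "D \<in> B" and self: "\<And>x y. x \<in> C \<Longrightarrow> y \<in> C \<Longrightarrow> ip (D x) y = ip x (D y)"
    and m: "m > 0" "\<And>x. x \<in> C \<Longrightarrow> m * (nrm x)\<^sup>2 \<le> e * Re (ip (D x) x)"
  shows "\<exists>R\<in>B. compose C R D = (\<lambda>x\<in>C. x) \<and> compose C D R = (\<lambda>x\<in>C. x)"
proof -
  note [simp] = B_in[OF D]
  obtain K where K: "K \<ge> 0" "\<And>x. x \<in> C \<Longrightarrow> nrm (D x) \<le> K * nrm x" using B_bound[OF D] by blast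
  have surj: "\<exists>z\<in>C. D z = y" if y: "y \<in> C" for y
  proof -
    have "\<exists>z\<in>C. \<forall>x\<in>C. ip x y = ip x (complex_of_real e \<odot> D z)"
    proof (rule lax_milgram_selfadjoint[where B = "\<bar>e\<bar> * K" and K = "nrm y" and m = m])
      fix u v assume "u \<in> C" "v \<in> C"
      then show "complex_of_real e \<odot> D (u \<oplus> v) = complex_of_real e \<odot> D u \<oplus> complex_of_real e \<odot> D v"
        by (intro ip_eqI) (simp_all add: B_add[OF D] algebra_simps)
    next
      fix c u assume "u \<in> C"
      then show "complex_of_real e \<odot> D (c \<odot> u) = c \<odot> (complex_of_real e \<odot> D u)"
        by (intro ip_eqI) (simp_all add: B_smult[OF D] algebra_simps)
    next
      fix u assume u: "u \<in> C"
      show "nrm (complex_of_real e \<odot> D u) \<le> \<bar>e\<bar> * K * nrm u"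
        using mult_left_mono[OF K(2)[OF u], of "\<bar>e\<bar>"] u by (simp add: nrm_smult)
      show "cmod (ip u y) \<le> nrm y * nrm u" using cauchy_schwarz[OF u y] by (simp add: mult.commute)
    qed (use m y self in \<open>auto simp: ip_smult_left\<close>)
    then obtain z where z: "z \<in> C" "\<And>x. x \<in> C \<Longrightarrow> ip x y = ip x (complex_of_real e \<odot> D z)" by blast
    have "y = complex_of_real e \<odot> D z" using z y by (intro ip_eqI_right) simp_all
    then have "D (complex_of_real e \<odot> z) = y" using z by (simp add: B_smult[OF D])
    then show ?thesis using z by (intro bexI[of _ "complex_of_real e \<odot> z"]) simp_all
  qed
  have low: "nrm x \<le> \<bar>e\<bar> / m * nrm (D x)" if x: "x \<in> C" for x
  proof (cases "nrm x = 0")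
    case True
    then show ?thesis using m x by simp
  next
    case False
    then have pos: "nrm x > 0" using nrm_nonneg[OF x] by linarith
    have "m * (nrm x)\<^sup>2 \<le> \<bar>e * Re (ip (D x) x)\<bar>" using m(2)[OF x] by linarith
    also have "\<dots> \<le> \<bar>e\<bar> * (nrm (D x) * nrm x)"
      using Re_ip_le[of "D x" x] x by (simp add: abs_mult mult_left_mono)
    finally show ?thesis using m(1) pos by (simp add: field_simps power2_eq_square)
  qed
  have inj: "x = y" if "x \<in> C" "y \<in> C" "D x = D y" for x y
  proof -
    have "D (x \<ominus> y) = \<zero>" using that by (simp add: B_minus[OF D] minus_eq_zero_iff)
    then show ?thesis using low[of "x \<ominus> y"] that by (intro eqI_nrm) simp_all
  qed
  define R where "R = (\<lambda>y. SOME z. z \<in> C \<and> D z = y)"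
  have R: "R y \<in> C" "D (R y) = y" if "y \<in> C" for y
    using someI_ex[of "\<lambda>z. z \<in> C \<and> D z = y"] surj[OF that] by (auto simp: R_def)
  have RD: "R (D x) = x" if "x \<in> C" for x
    by (rule inj[OF R(1)[OF B_in[OF D that]] that R(2)[OF B_in[OF D that]]])
  have "(\<lambda>y\<in>C. R y) \<in> B"
  proof (rule BI)
    fix x y assume xy: "x \<in> C" "y \<in> C"
    show "R (x \<oplus> y) = R x \<oplus> R y" by (rule inj) (use xy in \<open>simp_all add: R B_add[OF D]\<close>)
  next
    fix c x assume x: "x \<in> C"
    show "R (c \<odot> x) = c \<odot> R x" by (rule inj) (use x in \<open>simp_all add: R B_smult[OF D]\<close>)
  next
    fix x assume "x \<in> C"
    then show "nrm (R x) \<le> \<bar>e\<bar> / m * nrm x" using low[of "R x"] by (simp add: R)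
  qed (rule R)
  then show ?thesis
    by (rule bexI[rotated]) (simp add: compose_def RD R cong: restrict_cong)
qed

text \<open>Points above the range of the form are reached with \<open>e = 1\<close>, points below
  it with \<open>e = -1\<close>; in the application m is the distance of t from
  \<open>[0, M]\<close>.\<close>

lemma notin_op_spectrumI:
  fixes t e :: real
  assumes P: "P \<in> B" and self: "\<And>x y. x \<in> C \<Longrightarrow> y \<in> C \<Longrightarrow> ip (P x) y = ip x (P y)"
    and m: "m > 0" "\<And>x. x \<in> C \<Longrightarrow> m * (nrm x)\<^sup>2 \<le> e * (t * (nrm x)\<^sup>2 - Re (ip (P x) x))"
  shows "complex_of_real t \<notin> op_spectrum V P"
proof -
  note [simp] = B_in[OF P]
  let ?D = "op_diff V V (\<lambda>x\<in>C. complex_of_real t \<odot> x) P"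
  have "\<exists>R\<in>B. compose C R ?D = (\<lambda>x\<in>C. x) \<and> compose C ?D R = (\<lambda>x\<in>C. x)"
  proof (rule coercive_invertible[where m = m and e = e])
    show "?D \<in> B" by (intro op_diff_B scalar_B P)
    fix x assume x: "x \<in> C"
    have "Re (ip (?D x) x) = t * (nrm x)\<^sup>2 - Re (ip (P x) x)"
      using x by (simp add: op_diff_def nrm_sq)
    then show "m * (nrm x)\<^sup>2 \<le> e * Re (ip (?D x) x)" using m(2)[OF x] by simp
  qed (use m self in \<open>simp_all add: op_diff_def\<close>)
  then show ?thesis by (simp add: op_spectrum_def Let_def)
qed

text \<open>\<open>has_calculus P M h T\<close> says that \<open>T = h(P)\<close>, where \<open>h\<close> is approximated by polynomials on the
  interval \<open>[0, M]\<close>, which contains the spectrum of \<open>P\<close>, instead of on the spectrum itself.\<close>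

definition has_calculus :: "('a \<Rightarrow> 'a) \<Rightarrow> real \<Rightarrow> (real \<Rightarrow> real) \<Rightarrow> ('a \<Rightarrow> 'a) \<Rightarrow> bool" where
  "has_calculus P M h T \<longleftrightarrow> T \<in> B \<and> (\<forall>e>0. \<exists>p. (\<forall>t\<in>{0..M}. \<bar>poly p t - h t\<bar> \<le> e) \<and>
     (\<forall>x\<in>C. nrm (op_poly V p P x \<ominus> T x) \<le> e * nrm x))"

lemma has_calculusD:
  assumes "has_calculus P M h T" "e > 0"
  obtains p where "\<And>t. t \<in> {0..M} \<Longrightarrow> \<bar>poly p t - h t\<bar> \<le> e"
    "\<And>x. x \<in> C \<Longrightarrow> nrm (op_poly V p P x \<ominus> T x) \<le> e * nrm x"
  using assms unfolding has_calculus_def by blast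

lemma has_calculus_B: "has_calculus P M h T \<Longrightarrow> T \<in> B"
  by (simp add: has_calculus_def)

end

text \<open>M is a free upper bound of the form rather than the norm of P, so that two operators can
  be studied over one interval, as happens for the two compositions of an operator with its
  adjoint.\<close>

locale positive_op = hilbert_space V for V :: "'a cinner_space" (structure) +
  fixes P :: "'a \<Rightarrow> 'a" and M :: real
  assumes P: "P \<in> B"
    and self: "\<And>x y. x \<in> C \<Longrightarrow> y \<in> C \<Longrightarrow> ip (P x) y = ip x (P y)"
    and pos: "\<And>x. x \<in> C \<Longrightarrow> 0 \<le> Re (ip (P x) x)"
    and le_M: "\<And>x. x \<in> C \<Longrightarrow> Re (ip (P x) x) \<le> M * (nrm x)\<^sup>2"
    and M: "M \<ge> 0"
begin

lemma spectrum_subset: "complex_of_real t \<in> op_spectrum V P \<Longrightarrow> t \<in> {0..M}"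
proof (rule ccontr)
  assume spec: "complex_of_real t \<in> op_spectrum V P" and "t \<notin> {0..M}"
  then consider "t < 0" | "t > M" by force
  then show False
  proof cases
    case 1
    then show ?thesis
      using notin_op_spectrumI[OF P self, of "-t" "-1" t] spec pos by (simp add: algebra_simps)
  next
    case 2
    then show ?thesis
      using notin_op_spectrumI[OF P self, of "t - M" 1 t] spec le_M by (simp add: algebra_simps)
  qed
qed

lemma op_poly_norm_le_interval:
  assumes "\<And>t. t \<in> {0..M} \<Longrightarrow> \<bar>poly p t\<bar> \<le> K" and "x \<in> C"
  shows "nrm (op_poly V p P x) \<le> K * nrm x"
proof (rule op_poly_norm_le[OF P self _ _ assms(2)])
  show "K \<ge> 0" using assms(1)[of 0] M by simp
  show "\<bar>poly p t\<bar> \<le> K" if "complex_of_real t \<in> op_spectrum V P" for t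
    using assms(1) spectrum_subset[OF that] by simp
qed

abbreviation calc :: "(real \<Rightarrow> real) \<Rightarrow> ('a \<Rightarrow> 'a) \<Rightarrow> bool" where
  "calc \<equiv> has_calculus P M"

lemmas op_poly_in = B_in[OF op_poly_B[OF P]]

lemma calc_poly: "calc (poly p) (op_poly V p P)"
  unfolding has_calculus_def
proof (intro conjI allI impI op_poly_B[OF P] exI[of _ p] ballI)
  fix e :: real and x assume e: "e > 0" and x: "x \<in> C"
  have "op_poly V p P x \<ominus> op_poly V p P x = \<zero>"
    using minus_eq_zero_iff op_poly_in[OF x] by blast
  then show "nrm (op_poly V p P x \<ominus> op_poly V p P x) \<le> e * nrm x"
    using e x by simp
qed simp

text \<open>The error \<open>4 * e\<close> comes from two approximations on the interval and two of
  the operators. For polynomials h and k this is the Cauchy estimate behind existence; for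
  \<open>k = 0\<close> it bounds the norm.\<close>

lemma calc_diff_bound:
  assumes T: "calc h T" and R: "calc k R" and K: "\<And>t. t \<in> {0..M} \<Longrightarrow> \<bar>h t - k t\<bar> \<le> K" and x: "x \<in> C"
  shows "nrm (T x \<ominus> R x) \<le> K * nrm x"
proof (rule le_by_epsilon)
  fix e :: real assume e: "e > 0"
  obtain p where p: "\<And>t. t \<in> {0..M} \<Longrightarrow> \<bar>poly p t - h t\<bar> \<le> e"
    "\<And>x. x \<in> C \<Longrightarrow> nrm (op_poly V p P x \<ominus> T x) \<le> e * nrm x" using has_calculusD[OF T e] by blast
  obtain q where q: "\<And>t. t \<in> {0..M} \<Longrightarrow> \<bar>poly q t - k t\<bar> \<le> e"
    "\<And>x. x \<in> C \<Longrightarrow> nrm (op_poly V q P x \<ominus> R x) \<le> e * nrm x" using has_calculusD[OF R e] by blast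
  let ?p = "op_poly V p P x" and ?q = "op_poly V q P x"
  have [simp]: "?p \<in> C" "?q \<in> C" "T x \<in> C" "R x \<in> C"
    using op_poly_in B_in[OF has_calculus_B] T R x by blast+
  have "\<bar>poly (p - q) t\<bar> \<le> K + 2 * e" if "t \<in> {0..M}" for t
    using p(1)[OF that] q(1)[OF that] K[OF that] by (simp add: abs_le_iff)
  then have "nrm (op_poly V (p - q) P x) \<le> (K + 2 * e) * nrm x"
    using x by (rule op_poly_norm_le_interval)
  then have "nrm (?p \<ominus> ?q) \<le> (K + 2 * e) * nrm x" using x by (simp add: op_poly_minus[OF P])
  moreover have "nrm (T x \<ominus> R x) \<le> nrm (T x \<ominus> ?p) + (nrm (?p \<ominus> ?q) + nrm (?q \<ominus> R x))"
    using nrm_triangle_minus_mid[of "T x" ?p "R x"] nrm_triangle_minus_mid[of ?p ?q "R x"] by simp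
  ultimately show "nrm (T x \<ominus> R x) \<le> K * nrm x + (4 * nrm x) * e"
    using p(2)[OF x] q(2)[OF x] nrm_minus_commute[of "T x" ?p] by (simp add: algebra_simps)
qed

lemma calc_bound:
  assumes "calc h T" and "\<And>t. t \<in> {0..M} \<Longrightarrow> \<bar>h t\<bar> \<le> K" and x: "x \<in> C"
  shows "nrm (T x) \<le> K * nrm x"
  using calc_diff_bound[OF assms(1) calc_poly[of 0], of K x] assms B_in[OF has_calculus_B[OF assms(1)] x]
  by (simp add: op_poly_0[OF P] minus_eq_smult)

lemma calc_cong: "calc h T \<Longrightarrow> (\<And>t. t \<in> {0..M} \<Longrightarrow> h t = k t) \<Longrightarrow> calc k T"
  by (simp add: has_calculus_def)

lemma calc_self:
  assumes T: "calc h T" and x: "x \<in> C" and y: "y \<in> C"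
  shows "ip (T x) y = ip x (T y)"
proof -
  note [simp] = B_in[OF has_calculus_B[OF T]] op_poly_in
  have "cmod (ip (T x) y - ip x (T y)) \<le> 0"
  proof (rule le_by_epsilon)
    fix e :: real assume e: "e > 0"
    obtain p where p: "\<And>x. x \<in> C \<Longrightarrow> nrm (op_poly V p P x \<ominus> T x) \<le> e * nrm x"
      using has_calculusD[OF T e] by blast
    have "ip (T x) y - ip x (T y) = ip x (op_poly V p P y \<ominus> T y) - ip (op_poly V p P x \<ominus> T x) y"
      using x y op_poly_selfadjoint[OF P self x y, of p] by simp
    then have "cmod (ip (T x) y - ip x (T y))
        \<le> cmod (ip x (op_poly V p P y \<ominus> T y)) + cmod (ip (op_poly V p P x \<ominus> T x) y)"
      using norm_triangle_ineq4 by metis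
    also have "\<dots> \<le> nrm x * nrm (op_poly V p P y \<ominus> T y) + nrm (op_poly V p P x \<ominus> T x) * nrm y"
      using x y by (intro add_mono cauchy_schwarz) simp_all
    also have "\<dots> \<le> nrm x * (e * nrm y) + (e * nrm x) * nrm y"
      using x y by (intro add_mono mult_left_mono mult_right_mono p) simp_all
    finally show "cmod (ip (T x) y - ip x (T y)) \<le> 0 + (2 * nrm x * nrm y) * e"
      by (simp add: algebra_simps)
  qed
  then show ?thesis by simp
qed

text \<open>The approximants may be any functions that already have a calculus. Composition needs
  this: there they have the form \<open>poly p (k t)\<close>.\<close>

lemma calc_limit:
  assumes T: "T \<in> B"
    and approx: "\<And>e. e > 0 \<Longrightarrow> \<exists>k R. calc k R \<and> (\<forall>t\<in>{0..M}. \<bar>k t - h t\<bar> \<le> e) \<and>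
      (\<forall>x\<in>C. nrm (R x \<ominus> T x) \<le> e * nrm x)"
  shows "calc h T"
  unfolding has_calculus_def
proof (intro conjI T allI impI)
  fix e :: real assume "e > 0"
  then have e: "e / 2 > 0" by simp
  obtain k R where R: "calc k R" "\<And>t. t \<in> {0..M} \<Longrightarrow> \<bar>k t - h t\<bar> \<le> e / 2"
      "\<And>x. x \<in> C \<Longrightarrow> nrm (R x \<ominus> T x) \<le> e / 2 * nrm x"
    using approx[OF e] by blast
  obtain p where p: "\<And>t. t \<in> {0..M} \<Longrightarrow> \<bar>poly p t - k t\<bar> \<le> e / 2"
    "\<And>x. x \<in> C \<Longrightarrow> nrm (op_poly V p P x \<ominus> R x) \<le> e / 2 * nrm x"
    using has_calculusD[OF R(1) e] by blast
  have "\<bar>poly p t - h t\<bar> \<le> e" if "t \<in> {0..M}" for t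
    using R(2)[OF that] p(1)[OF that] by linarith
  moreover have "nrm (op_poly V p P x \<ominus> T x) \<le> e * nrm x" if x: "x \<in> C" for x
    using nrm_triangle_minus_mid[of "op_poly V p P x" "R x" "T x"] p(2)[OF x] R(3)[OF x]
      op_poly_in[OF x] B_in[OF T x] B_in[OF has_calculus_B[OF R(1)] x] by (simp add: field_simps)
  ultimately show "\<exists>p. (\<forall>t\<in>{0..M}. \<bar>poly p t - h t\<bar> \<le> e) \<and>
      (\<forall>x\<in>C. nrm (op_poly V p P x \<ominus> T x) \<le> e * nrm x)" by blast
qed

lemma calc_add:
  assumes T: "calc h T" and R: "calc k R"
  shows "calc (\<lambda>t. h t + k t) (op_add V V T R)"
  unfolding has_calculus_def
proof (intro conjI op_add_B has_calculus_B[OF T] has_calculus_B[OF R] allI impI)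
  note [simp] = B_in[OF has_calculus_B[OF T]] B_in[OF has_calculus_B[OF R]] op_poly_in
  fix e :: real assume "e > 0"
  then have e: "e / 2 > 0" by simp
  obtain p where p: "\<And>t. t \<in> {0..M} \<Longrightarrow> \<bar>poly p t - h t\<bar> \<le> e / 2"
    "\<And>x. x \<in> C \<Longrightarrow> nrm (op_poly V p P x \<ominus> T x) \<le> e / 2 * nrm x" using has_calculusD[OF T e] by blast
  obtain q where q: "\<And>t. t \<in> {0..M} \<Longrightarrow> \<bar>poly q t - k t\<bar> \<le> e / 2"
    "\<And>x. x \<in> C \<Longrightarrow> nrm (op_poly V q P x \<ominus> R x) \<le> e / 2 * nrm x" using has_calculusD[OF R e] by blast
  have "\<bar>poly (p + q) t - (h t + k t)\<bar> \<le> e" if "t \<in> {0..M}" for t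
    using q(1)[OF that] p(1)[OF that] unfolding poly_add by linarith
  moreover have "nrm (op_poly V (p + q) P x \<ominus> op_add V V T R x) \<le> e * nrm x" if x: "x \<in> C" for x
  proof -
    have "op_poly V (p + q) P x \<ominus> op_add V V T R x
        = (op_poly V p P x \<ominus> T x) \<oplus> (op_poly V q P x \<ominus> R x)"
      using x by (intro ip_eqI) (simp_all add: op_poly_add[OF P] op_add_def)
    then show ?thesis
      using nrm_triangle[of "op_poly V p P x \<ominus> T x" "op_poly V q P x \<ominus> R x"] p(2)[OF x] q(2)[OF x] x
      by (simp add: field_simps)
  qed
  ultimately show "\<exists>p. (\<forall>t\<in>{0..M}. \<bar>poly p t - (h t + k t)\<bar> \<le> e) \<and>
      (\<forall>x\<in>C. nrm (op_poly V p P x \<ominus> op_add V V T R x) \<le> e * nrm x)" by blast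
qed

lemma calc_mult:
  assumes T: "calc h T" and R: "calc k R"
    and h: "continuous_on {0..M} h" and k: "continuous_on {0..M} k"
  shows "calc (\<lambda>t. h t * k t) (compose C T R)"
  unfolding has_calculus_def
proof (intro conjI compose_B has_calculus_B[OF T] has_calculus_B[OF R] allI impI)
  note [simp] = B_in[OF has_calculus_B[OF T]] B_in[OF has_calculus_B[OF R]] op_poly_in
  obtain K where K: "K \<ge> 0" "\<And>t. t \<in> {0..M} \<Longrightarrow> \<bar>h t\<bar> \<le> K"
    using continuous_on_interval_bound[OF h] by blast
  obtain L where L: "L \<ge> 0" "\<And>t. t \<in> {0..M} \<Longrightarrow> \<bar>k t\<bar> \<le> L"
    using continuous_on_interval_bound[OF k] by blast
  fix e :: real assume e0: "e > 0"
  \<comment> \<open>\<open>d \<le> 1\<close> keeps \<bar>p\<bar> below \<open>K + 1\<close>, so that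
    the total error is \<open>(K + 1) * d + d * L\<close>, which is at most e.\<close>
  define d where "d = min 1 (e / (K + L + 1))"
  have d: "d > 0" "d \<le> 1" using e0 K L by (auto simp: d_def intro!: divide_pos_pos)
  have "d \<le> e / (K + L + 1)" by (simp add: d_def)
  then have de: "(K + 1) * d + d * L \<le> e" using K L by (simp add: field_simps)
  obtain p where p: "\<And>t. t \<in> {0..M} \<Longrightarrow> \<bar>poly p t - h t\<bar> \<le> d"
    "\<And>x. x \<in> C \<Longrightarrow> nrm (op_poly V p P x \<ominus> T x) \<le> d * nrm x" using has_calculusD[OF T d(1)] by blast
  obtain q where q: "\<And>t. t \<in> {0..M} \<Longrightarrow> \<bar>poly q t - k t\<bar> \<le> d"
    "\<And>x. x \<in> C \<Longrightarrow> nrm (op_poly V q P x \<ominus> R x) \<le> d * nrm x" using has_calculusD[OF R d(1)] by blast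
  have pK: "\<bar>poly p t\<bar> \<le> K + 1" if "t \<in> {0..M}" for t
    using p(1)[OF that] K(2)[OF that] d(2) by linarith
  have "\<bar>poly (p * q) t - h t * k t\<bar> \<le> e" if t: "t \<in> {0..M}" for t
  proof -
    have "poly (p * q) t - h t * k t = poly p t * (poly q t - k t) + (poly p t - h t) * k t"
      by (simp add: algebra_simps)
    also have "\<bar>\<dots>\<bar> \<le> \<bar>poly p t\<bar> * \<bar>poly q t - k t\<bar> + \<bar>poly p t - h t\<bar> * \<bar>k t\<bar>"
      by (metis abs_mult abs_triangle_ineq)
    also have "\<dots> \<le> (K + 1) * d + d * L"
      using K(1) d(1) by (intro add_mono mult_mono pK[OF t] q(1)[OF t] p(1)[OF t] L(2)[OF t]) auto
    finally show ?thesis using de by simp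
  qed
  moreover have "nrm (op_poly V (p * q) P x \<ominus> compose C T R x) \<le> e * nrm x" if x: "x \<in> C" for x
  proof -
    define u where "u = op_poly V q P x \<ominus> R x"
    have u: "u \<in> C" using x by (simp add: u_def)
    have "op_poly V (p * q) P x \<ominus> compose C T R x = op_poly V p P u \<oplus> (op_poly V p P (R x) \<ominus> T (R x))"
      using x by (intro ip_eqI)
        (simp_all add: op_poly_mult[OF P] compose_def u_def B_minus[OF op_poly_B[OF P]])
    then have "nrm (op_poly V (p * q) P x \<ominus> compose C T R x)
        \<le> nrm (op_poly V p P u) + nrm (op_poly V p P (R x) \<ominus> T (R x))"
      using nrm_triangle[of "op_poly V p P u" "op_poly V p P (R x) \<ominus> T (R x)"] x u by simp
    also have "\<dots> \<le> (K + 1) * nrm u + d * nrm (R x)"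
      using op_poly_norm_le_interval[OF pK u] p(2)[of "R x"] x by simp
    also have "\<dots> \<le> (K + 1) * (d * nrm x) + d * (L * nrm x)"
      using q(2)[OF x] calc_bound[OF R L(2) x] K(1) d(1)
      by (intro add_mono mult_left_mono) (simp_all add: u_def)
    also have "\<dots> = ((K + 1) * d + d * L) * nrm x" by (simp add: algebra_simps)
    also have "\<dots> \<le> e * nrm x" using de x by (intro mult_right_mono) simp_all
    finally show ?thesis .
  qed
  ultimately show "\<exists>p. (\<forall>t\<in>{0..M}. \<bar>poly p t - h t * k t\<bar> \<le> e) \<and>
      (\<forall>x\<in>C. nrm (op_poly V p P x \<ominus> compose C T R x) \<le> e * nrm x)" by blast
qed

lemma calc_exists:
  assumes h: "continuous_on {0..M} h"
  shows "\<exists>T. calc h T"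
proof -
  have "\<exists>p. \<forall>t\<in>{0..M}. \<bar>poly p t - h t\<bar> \<le> inverse (real (Suc n))" for n
    by (rule exists_poly_approx[OF h]) simp
  then obtain p where p: "\<And>n t. t \<in> {0..M} \<Longrightarrow> \<bar>poly (p n) t - h t\<bar> \<le> inverse (real (Suc n))"
    by metis
  let ?e = "\<lambda>n. inverse (real (Suc n))"
  define X where "X = (\<lambda>n. op_poly V (p n) P)"
  have XB: "X n \<in> B" for n by (simp add: X_def op_poly_B[OF P])
  note [simp] = B_in[OF XB]
  have diff: "nrm (X m x \<ominus> X n x) \<le> (?e m + ?e n) * nrm x" if "x \<in> C" for m n x
    unfolding X_def
  proof (rule calc_diff_bound[OF calc_poly calc_poly _ that])
    fix t assume "t \<in> {0..M}"
    then show "\<bar>poly (p m) t - poly (p n) t\<bar> \<le> ?e m + ?e n" using p[of t m] p[of t n] by linarith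
  qed
  have lim0: "(\<lambda>n. c * ?e n) \<longlonglongrightarrow> 0" for c
    using tendsto_mult[OF tendsto_const[of c] LIMSEQ_inverse_real_of_nat] by simp
  have "\<exists>L\<in>C. (\<lambda>n. nrm (X n x \<ominus> L)) \<longlonglongrightarrow> 0" if x: "x \<in> C" for x
  proof (rule complete)
    fix e :: real assume e: "e > 0"
    obtain N where N: "\<And>n. n \<ge> N \<Longrightarrow> \<bar>(2 * nrm x) * ?e n\<bar> < e"
      using LIMSEQ_D[OF lim0 e] by auto
    have "nrm (X m x \<ominus> X n x) < e" if "m \<ge> N" "n \<ge> N" for m n
    proof -
      have "?e m \<le> ?e N" "?e n \<le> ?e N" using that by (auto intro!: le_imp_inverse_le)
      then have "?e m + ?e n \<le> 2 * ?e N" by linarith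
      then have "(?e m + ?e n) * nrm x \<le> (2 * ?e N) * nrm x" using x by (intro mult_right_mono) simp_all
      then show ?thesis using diff[OF x, of m n] N[of N] by (simp add: mult.commute mult.left_commute)
    qed
    then show "\<exists>N. \<forall>m\<ge>N. \<forall>n\<ge>N. nrm (X m x \<ominus> X n x) < e" by blast
  qed (use x in simp)
  then obtain T where T: "\<And>x. x \<in> C \<Longrightarrow> T x \<in> C"
      "\<And>x. x \<in> C \<Longrightarrow> (\<lambda>n. nrm (X n x \<ominus> T x)) \<longlonglongrightarrow> 0" by metis
  \<comment> \<open>Passing to the limit in \<open>diff\<close> gives a rate uniform on bounded
    sets; linearity, boundedness and norm convergence of the limit all follow from it.\<close>
  have XT: "nrm (X m x \<ominus> T x) \<le> ?e m * nrm x" if x: "x \<in> C" for m x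
  proof (rule LIMSEQ_le_const)
    show "(\<lambda>n. ?e m * nrm x + nrm x * ?e n + nrm (X n x \<ominus> T x)) \<longlonglongrightarrow> ?e m * nrm x"
      using tendsto_add[OF tendsto_add[OF tendsto_const[of "?e m * nrm x"] lim0] T(2)[OF x]] by simp
    have "nrm (X m x \<ominus> T x) \<le> ?e m * nrm x + nrm x * ?e n + nrm (X n x \<ominus> T x)" for n
      using nrm_triangle_minus_mid[of "X m x" "X n x" "T x"] diff[OF x, of m n] x T(1)[OF x]
      by (simp add: algebra_simps)
    then show "\<exists>N. \<forall>n\<ge>N. nrm (X m x \<ominus> T x) \<le> ?e m * nrm x + nrm x * ?e n + nrm (X n x \<ominus> T x)"
      by blast
  qed
  have eqI: "u = v" if "u \<in> C" "v \<in> C" "\<And>n. nrm (u \<ominus> v) \<le> c * ?e n" for u v c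
  proof -
    have "nrm (u \<ominus> v) \<le> 0" using LIMSEQ_le_const[OF lim0[of c]] that(3) by blast
    then show ?thesis using that by (intro eqI_nrm)
  qed
  obtain K where K: "K \<ge> 0" "\<And>x. x \<in> C \<Longrightarrow> nrm (X 0 x) \<le> K * nrm x" using B_bound[OF XB] by blast
  have TB: "(\<lambda>x\<in>C. T x) \<in> B"
  proof (rule BI)
    fix x y assume xy: "x \<in> C" "y \<in> C"
    show "T (x \<oplus> y) = T x \<oplus> T y"
    proof (rule eqI)
      fix n
      \<comment> \<open>The values of the additive map \<open>X n\<close> cancel, so the defect of
        additivity of T is a combination of three approximation errors.\<close>
      have "T (x \<oplus> y) \<ominus> (T x \<oplus> T y)
          = ((X n x \<ominus> T x) \<oplus> (X n y \<ominus> T y)) \<ominus> (X n (x \<oplus> y) \<ominus> T (x \<oplus> y))"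
        using xy T(1) by (intro ip_eqI) (simp_all add: B_add[OF XB])
      then have "nrm (T (x \<oplus> y) \<ominus> (T x \<oplus> T y))
          \<le> nrm (X n x \<ominus> T x) + nrm (X n y \<ominus> T y) + nrm (X n (x \<oplus> y) \<ominus> T (x \<oplus> y))"
        using nrm_triangle_minus[of "(X n x \<ominus> T x) \<oplus> (X n y \<ominus> T y)" "X n (x \<oplus> y) \<ominus> T (x \<oplus> y)"]
          nrm_triangle[of "X n x \<ominus> T x" "X n y \<ominus> T y"] xy T(1) by simp
      also have "\<dots> \<le> (nrm x + nrm y + nrm (x \<oplus> y)) * ?e n"
        using XT[OF xy(1), of n] XT[OF xy(2), of n] XT[of "x \<oplus> y" n] xy by (simp add: algebra_simps)
      finally show "nrm (T (x \<oplus> y) \<ominus> (T x \<oplus> T y)) \<le> (nrm x + nrm y + nrm (x \<oplus> y)) * ?e n" .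
    qed (use xy T in simp_all)
  next
    fix c x assume x: "x \<in> C"
    show "T (c \<odot> x) = c \<odot> T x"
    proof (rule eqI)
      fix n
      have "T (c \<odot> x) \<ominus> c \<odot> T x = c \<odot> (X n x \<ominus> T x) \<ominus> (X n (c \<odot> x) \<ominus> T (c \<odot> x))"
        using x T(1) by (intro ip_eqI) (simp_all add: B_smult[OF XB] algebra_simps)
      then have "nrm (T (c \<odot> x) \<ominus> c \<odot> T x)
          \<le> cmod c * nrm (X n x \<ominus> T x) + nrm (X n (c \<odot> x) \<ominus> T (c \<odot> x))"
        using nrm_triangle_minus[of "c \<odot> (X n x \<ominus> T x)" "X n (c \<odot> x) \<ominus> T (c \<odot> x)"] x T(1)
        by (simp add: nrm_smult)
      also have "\<dots> \<le> (cmod c * nrm x + nrm (c \<odot> x)) * ?e n"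
        using mult_left_mono[OF XT[OF x, of n], of "cmod c"] XT[of "c \<odot> x" n] x
        by (simp add: algebra_simps)
      finally show "nrm (T (c \<odot> x) \<ominus> c \<odot> T x) \<le> (cmod c * nrm x + nrm (c \<odot> x)) * ?e n" .
    qed (use x T in simp_all)
  next
    fix x assume x: "x \<in> C"
    \<comment> \<open>The 1 is the error \<open>?e 0\<close> of the approximant \<open>X 0\<close>,
      which is itself bounded by K.\<close>
    show "nrm (T x) \<le> (1 + K) * nrm x"
      using nrm_le_minus[of "T x" "X 0 x"] XT[OF x, of 0] K(2)[OF x] x T(1)[OF x]
        nrm_minus_commute[of "T x" "X 0 x"] by (simp add: algebra_simps)
  qed (rule T)
  have "calc h (\<lambda>x\<in>C. T x)"
  proof (rule calc_limit[OF TB])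
    fix e :: real assume "e > 0"
    then obtain n where n: "?e n < e" using reals_Archimedean by blast
    show "\<exists>k R. calc k R \<and> (\<forall>t\<in>{0..M}. \<bar>k t - h t\<bar> \<le> e) \<and>
      (\<forall>x\<in>C. nrm (R x \<ominus> (\<lambda>x\<in>C. T x) x) \<le> e * nrm x)"
    proof (intro exI conjI ballI)
      show "calc (poly (p n)) (X n)" unfolding X_def by (rule calc_poly)
      show "\<bar>poly (p n) t - h t\<bar> \<le> e" if "t \<in> {0..M}" for t using p[OF that, of n] n by linarith
      show "nrm (X n x \<ominus> (\<lambda>x\<in>C. T x) x) \<le> e * nrm x" if x: "x \<in> C" for x
        using XT[OF x, of n] mult_right_mono[OF less_imp_le[OF n] nrm_nonneg[OF x]] x by simp
    qed
  qed
  then show ?thesis by blast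
qed

text \<open>A competitor R is approximated by polynomials that converge to h on the spectrum only,
  whereas T is approximated on the whole interval. The two sequences are compared on the spectrum,
  where \<open>op_poly_norm_le\<close> applies.\<close>

lemma op_fun_eqI:
  assumes T: "calc h T"
  shows "op_fun V h P = T"
  unfolding op_fun_def
proof (rule the_equality)
  let ?e = "\<lambda>n. inverse (real (Suc n))" and ?S = "{t. complex_of_real t \<in> op_spectrum V P}"
  have TB: "T \<in> B" by (rule has_calculus_B[OF T])
  have "\<exists>p. (\<forall>t\<in>{0..M}. \<bar>poly p t - h t\<bar> \<le> ?e n) \<and>
     (\<forall>x\<in>C. nrm (op_poly V p P x \<ominus> T x) \<le> ?e n * nrm x)" for n
    using T unfolding has_calculus_def by simp
  then obtain p where p: "\<And>n t. t \<in> {0..M} \<Longrightarrow> \<bar>poly (p n) t - h t\<bar> \<le> ?e n"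
     "\<And>n x. x \<in> C \<Longrightarrow> nrm (op_poly V (p n) P x \<ominus> T x) \<le> ?e n * nrm x" by metis
  have "uniform_limit ?S (\<lambda>k. poly (p k)) h sequentially"
    unfolding uniform_limit_iff
  proof (intro allI impI)
    fix e :: real assume e: "e > 0"
    show "\<forall>\<^sub>F n in sequentially. \<forall>t\<in>?S. dist (poly (p n) t) (h t) < e"
      using order_tendstoD(2)[OF LIMSEQ_inverse_real_of_nat e]
    proof eventually_elim
      case (elim n)
      have "\<bar>poly (p n) t - h t\<bar> < e" if "complex_of_real t \<in> op_spectrum V P" for t
        using p(1)[OF spectrum_subset[OF that], of n] elim by linarith
      then show ?case by (simp add: dist_real_def)
    qed
  qed
  moreover have "(\<lambda>k. op_norm V V (op_diff V V (op_poly V (p k) P) T)) \<longlonglongrightarrow> 0"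
  proof (rule tendsto_sandwich[OF _ _ tendsto_const LIMSEQ_inverse_real_of_nat])
    show "\<forall>\<^sub>F k in sequentially. 0 \<le> op_norm V V (op_diff V V (op_poly V (p k) P) T)"
      by (intro always_eventually allI op_norm_nonneg complex_hilbert op_diff_B op_poly_B[OF P] TB)
    show "\<forall>\<^sub>F k in sequentially. op_norm V V (op_diff V V (op_poly V (p k) P) T) \<le> ?e k"
      by (intro always_eventually allI op_norm_le complex_hilbert)
        (simp_all add: op_diff_def p(2) del: of_nat_Suc)
  qed
  ultimately show "T \<in> B \<and> (\<exists>p. uniform_limit ?S (\<lambda>k. poly (p k)) h sequentially \<and>
      (\<lambda>k. op_norm V V (op_diff V V (op_poly V (p k) P) T)) \<longlonglongrightarrow> 0)" using TB by blast
  fix R assume R: "R \<in> B \<and> (\<exists>p. uniform_limit ?S (\<lambda>k. poly (p k)) h sequentially \<and>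
      (\<lambda>k. op_norm V V (op_diff V V (op_poly V (p k) P) R)) \<longlonglongrightarrow> 0)"
  then obtain q where RB: "R \<in> B" and q: "uniform_limit ?S (\<lambda>k. poly (q k)) h sequentially"
    "(\<lambda>k. op_norm V V (op_diff V V (op_poly V (q k) P) R)) \<longlonglongrightarrow> 0" by blast
  show "R = T"
  proof (rule bounded_ops_eqI[OF RB TB])
    fix x assume x: "x \<in> C"
    note [simp] = B_in[OF RB x] B_in[OF TB x] op_poly_in[OF x]
    have "nrm (R x \<ominus> T x) \<le> 0"
    proof (rule le_by_epsilon)
      fix e :: real assume e: "e > 0"
      have "\<forall>\<^sub>F n in sequentially. nrm (R x \<ominus> T x) \<le> 4 * e * nrm x"
        using order_tendstoD(2)[OF LIMSEQ_inverse_real_of_nat e] order_tendstoD(2)[OF q(2) e]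
          uniform_limitD[OF q(1) e]
      proof eventually_elim
        case (elim n)
        let ?p = "op_poly V (p n) P x" and ?q = "op_poly V (q n) P x"
        have D: "op_diff V V (op_poly V (q n) P) R \<in> B" by (intro op_diff_B op_poly_B[OF P] RB)
        have "nrm (?q \<ominus> R x) \<le> op_norm V V (op_diff V V (op_poly V (q n) P) R) * nrm x"
          using op_norm_bound[OF complex_hilbert complex_hilbert D x] x by (simp add: op_diff_def)
        also have "\<dots> \<le> e * nrm x" using elim(2) x by (intro mult_right_mono) simp_all
        finally have 1: "nrm (R x \<ominus> ?q) \<le> e * nrm x" using nrm_minus_commute[of "R x" ?q] by simp
        have "\<bar>poly (q n - p n) t\<bar> \<le> 2 * e" if t: "complex_of_real t \<in> op_spectrum V P" for t
        proof -
          have "\<bar>poly (q n) t - h t\<bar> < e" using elim(3) t by (auto simp: dist_real_def)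
          then show ?thesis
            using p(1)[OF spectrum_subset[OF t], of n] elim(1) unfolding poly_diff by linarith
        qed
        then have "nrm (op_poly V (q n - p n) P x) \<le> 2 * e * nrm x"
          using e by (intro op_poly_norm_le[OF P self] x) simp_all
        then have 2: "nrm (?q \<ominus> ?p) \<le> 2 * e * nrm x" using x by (simp add: op_poly_minus[OF P])
        have 3: "nrm (?p \<ominus> T x) \<le> e * nrm x"
          using p(2)[OF x, of n] mult_right_mono[OF less_imp_le[OF elim(1)] nrm_nonneg[OF x]] by simp
        \<comment> \<open>One e for R, two for the polynomials on the spectrum and one for T make up
          the factor 4.\<close>
        show ?case
          using nrm_triangle_minus_mid[of "R x" ?q "T x"] nrm_triangle_minus_mid[of ?q ?p "T x"] 1 2 3
          by simp
      qed
      then show "nrm (R x \<ominus> T x) \<le> 0 + (4 * nrm x) * e" by (simp add: algebra_simps)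
    qed
    then show "R x = T x" by (intro eqI_nrm) simp_all
  qed
qed

end

section \<open>Convexity of real powers\<close>

lemma powr_above_tangent:
  fixes u y s :: real
  assumes "u > 0" "y \<ge> 0" "s \<ge> 1"
  shows "u powr s + s * u powr (s - 1) * (y - u) \<le> y powr s"
proof -
  have us: "u powr s = u * u powr (s - 1)" using assms by (simp add: powr_diff)
  \<comment> \<open>Young's inequality with weights 1/s and 1 - 1/s for
    \<open>(y / u) powr s\<close> and 1; multiplied by \<open>s * u powr (s - 1)\<close> it becomes
    the tangent bound.\<close>
  have "y \<le> u * ((y / u) powr s / s + (1 - 1 / s))"
  proof (cases "y = 0")
    case True
    then show ?thesis using assms by simp
  next
    case False
    then have "((y / u) powr s) powr (1 / s) * 1 powr (1 - 1 / s) \<le> 1 / s * (y / u) powr s + (1 - 1 / s) * 1"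
      using assms by (intro Youngs_inequality_0) auto
    then have "y / u \<le> (y / u) powr s / s + (1 - 1 / s)"
      using assms False by (simp add: powr_powr)
    then show ?thesis using assms by (simp add: field_simps)
  qed
  then have "s * u powr (s - 1) * y \<le> s * u powr (s - 1) * (u * ((y / u) powr s / s + (1 - 1 / s)))"
    using assms by (intro mult_left_mono) auto
  also have "\<dots> = u powr s * (y / u) powr s + (s - 1) * u powr s"
    using assms by (simp add: us algebra_simps)
  also have "u powr s * (y / u) powr s = y powr s"
    using assms by (simp add: powr_divide)
  finally show ?thesis by (simp add: us algebra_simps)
qed

lemma sum_powr_le:
  fixes a :: "'i \<Rightarrow> real"
  assumes "finite I" "\<And>i. i \<in> I \<Longrightarrow> a i \<ge> 0" "s \<ge> 1"
  shows "(\<Sum>i\<in>I. a i) powr s \<le> real (card I) powr (s - 1) * (\<Sum>i\<in>I. a i powr s)"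
proof (cases "(\<Sum>i\<in>I. a i) = 0")
  case True
  then show ?thesis by (simp add: sum_nonneg)
next
  case False
  then have ne: "card I > 0" using assms(1) by (auto simp: card_gt_0_iff)
  define N where "N = real (card I)"
  have N: "N > 0" using ne by (simp add: N_def)
  define u where "u = (\<Sum>i\<in>I. a i) / N"
  have S: "(\<Sum>i\<in>I. a i) = N * u" using N by (simp add: u_def)
  have u: "u > 0" using False N assms(2) by (simp add: u_def order.not_eq_order_implies_strict sum_nonneg)
  \<comment> \<open>At the mean u the linear parts of the tangents add up to 0.\<close>
  have "N * u powr s = (\<Sum>i\<in>I. u powr s + s * u powr (s - 1) * (a i - u))"
    by (simp add: sum.distrib sum_subtractf S N_def flip: sum_distrib_left)
  also have "\<dots> \<le> (\<Sum>i\<in>I. a i powr s)"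
    by (intro sum_mono powr_above_tangent u assms)
  finally have "N powr (s - 1) * (N * u powr s) \<le> N powr (s - 1) * (\<Sum>i\<in>I. a i powr s)"
    by (intro mult_left_mono) auto
  moreover have "N powr (s - 1) * (N * u powr s) = (N * u) powr s"
    using N u by (simp add: powr_mult powr_diff)
  ultimately show ?thesis by (simp add: S N_def)
qed

section \<open>Adjoint and numerical radius\<close>

context hilbert_space
begin

lemma adjoint_unique:
  assumes "R \<in> B" "\<And>x y. x \<in> C \<Longrightarrow> y \<in> C \<Longrightarrow> ip (T x) y = ip x (R y)"
  shows "adjoint_op V V T = R"
  unfolding adjoint_op_def
proof (rule the_equality)
  fix R' assume R': "R' \<in> B \<and> (\<forall>x\<in>C. \<forall>y\<in>C. ip (T x) y = ip x (R' y))"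
  show "R' = R"
  proof (rule bounded_ops_eqI)
    fix x assume x: "x \<in> C"
    show "R' x = R x"
      by (rule ip_eqI_right) (use R' x assms B_in[of R' x] B_in[of R x] in auto)
  qed (use R' assms in auto)
qed (use assms in auto)

text \<open>Lax--Milgram with the identity as D represents the functional
  \<open>x \<mapsto> \<langle>T x, y\<rangle>\<close>; this is the Riesz theorem. Uniqueness of the
  representing vector makes it depend linearly on y.\<close>

lemma adjoint_exists:
  assumes T: "T \<in> B"
  shows "\<exists>R\<in>B. \<forall>x\<in>C. \<forall>y\<in>C. ip (T x) y = ip x (R y)"
proof -
  note [simp] = B_in[OF T]
  obtain K where K: "K \<ge> 0" "\<And>x. x \<in> C \<Longrightarrow> nrm (T x) \<le> K * nrm x" using B_bound[OF T] by blast
  have "\<exists>z\<in>C. \<forall>x\<in>C. ip (T x) y = ip x z" if y: "y \<in> C" for y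
  proof (rule lax_milgram_selfadjoint[where D = "\<lambda>x. x" and B = 1 and m = 1 and K = "K * nrm y"])
    fix x assume x: "x \<in> C"
    have "cmod (ip (T x) y) \<le> nrm (T x) * nrm y" using x y by (simp add: cauchy_schwarz)
    also have "\<dots> \<le> K * nrm x * nrm y" using K(2)[OF x] y by (intro mult_right_mono) auto
    finally show "cmod (ip (T x) y) \<le> K * nrm y * nrm x" by (simp add: algebra_simps)
  qed (use y in \<open>simp_all add: B_add[OF T] B_smult[OF T] nrm_sq\<close>)
  then obtain R where R: "\<And>y. y \<in> C \<Longrightarrow> R y \<in> C"
    "\<And>x y. y \<in> C \<Longrightarrow> x \<in> C \<Longrightarrow> ip (T x) y = ip x (R y)" by metis
  have "(\<lambda>y\<in>C. R y) \<in> B"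
  proof (rule BI)
    fix x y assume "x \<in> C" "y \<in> C"
    then show "R (x \<oplus> y) = R x \<oplus> R y" by (intro ip_eqI_right) (simp_all add: R(1) flip: R(2))
  next
    fix c x assume "x \<in> C"
    then show "R (c \<odot> x) = c \<odot> R x" by (intro ip_eqI_right) (simp_all add: R(1) flip: R(2))
  next
    fix y assume y: "y \<in> C"
    have "(nrm (R y))\<^sup>2 = Re (ip (T (R y)) y)" using y by (simp add: R nrm_sq)
    also have "\<dots> \<le> nrm (T (R y)) * nrm y" using Re_ip_le[of "T (R y)" y] y R(1) by simp
    also have "\<dots> \<le> K * nrm (R y) * nrm y" using K(2)[OF R(1)[OF y]] y by (intro mult_right_mono) auto
    finally have "nrm (R y) * nrm (R y) \<le> (K * nrm y) * nrm (R y)" by (simp add: power2_eq_square algebra_simps)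
    then show "nrm (R y) \<le> K * nrm y"
      using K(1) y nrm_nonneg[OF R(1)[OF y]] by (cases "nrm (R y) = 0") auto
  qed (rule R)
  then show ?thesis using R by (intro bexI[of _ "\<lambda>y\<in>C. R y"]) auto
qed

lemma
  assumes T: "T \<in> B"
  shows adjoint_B: "adjoint_op V V T \<in> B"
    and adjoint: "x \<in> C \<Longrightarrow> y \<in> C \<Longrightarrow> ip (T x) y = ip x (adjoint_op V V T y)"
proof -
  obtain R where R: "R \<in> B" "\<And>x y. x \<in> C \<Longrightarrow> y \<in> C \<Longrightarrow> ip (T x) y = ip x (R y)"
    using adjoint_exists[OF T] by blast
  have "adjoint_op V V T = R" by (rule adjoint_unique[OF R])
  then show "adjoint_op V V T \<in> B" "x \<in> C \<Longrightarrow> y \<in> C \<Longrightarrow> ip (T x) y = ip x (adjoint_op V V T y)"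
    using R by auto
qed

lemma adjoint_adjoint:
  assumes T: "T \<in> B"
  shows "adjoint_op V V (adjoint_op V V T) = T"
proof (rule adjoint_unique[OF T])
  fix x y assume xy: "x \<in> C" "y \<in> C"
  have "ip (adjoint_op V V T x) y = cnj (ip y (adjoint_op V V T x))"
    using xy B_in[OF adjoint_B[OF T]] by (intro cinner_commute) auto
  also have "\<dots> = cnj (ip (T y) x)" using adjoint[OF T xy(2,1)] by simp
  also have "\<dots> = ip x (T y)" using xy B_in[OF T] by (intro cinner_commute[symmetric]) auto
  finally show "ip (adjoint_op V V T x) y = ip x (T y)" .
qed

lemma
  assumes T: "T \<in> B"
  shows numerical_radius_nonneg: "0 \<le> numerical_radius V T"
    and numerical_radius_bound: "x \<in> C \<Longrightarrow> cmod (ip (T x) x) \<le> numerical_radius V T * (nrm x)\<^sup>2"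
proof -
  note [simp] = B_in[OF T]
  let ?S = "insert 0 {cmod (ip (T x) x) | x. x \<in> C \<and> nrm x = 1}"
  obtain K where K: "K \<ge> 0" "\<And>x. x \<in> C \<Longrightarrow> nrm (T x) \<le> K * nrm x" using B_bound[OF T] by blast
  have bdd: "bdd_above ?S"
  proof (rule bdd_aboveI)
    fix r assume "r \<in> ?S"
    then consider "r = 0" | x where "x \<in> C" "nrm x = 1" "r = cmod (ip (T x) x)" by blast
    then show "r \<le> K"
    proof cases
      case 2
      then show ?thesis using cauchy_schwarz[of "T x" x] K(2)[of x] by simp
    qed (use K in simp)
  qed
  show "0 \<le> numerical_radius V T"
    unfolding numerical_radius_def by (rule cSup_upper[OF _ bdd]) simp
  show "cmod (ip (T x) x) \<le> numerical_radius V T * (nrm x)\<^sup>2" if x: "x \<in> C"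
  proof (cases "nrm x = 0")
    case True
    then show ?thesis using x by (simp add: nrm_eq_0 B_zero[OF T])
  next
    case False
    then have pos: "nrm x > 0" using nrm_nonneg[OF x] by linarith
    define t where "t = inverse (nrm x)"
    define y where "y = complex_of_real t \<odot> x"
    have y: "y \<in> C" "nrm y = 1" using x pos by (simp_all add: y_def nrm_smult t_def norm_inverse)
    have "cmod (ip (T y) y) \<le> numerical_radius V T"
      unfolding numerical_radius_def by (rule cSup_upper[OF _ bdd]) (use y in blast)
    moreover have "ip (T y) y = complex_of_real (t * t) * ip (T x) x"
      using x by (simp add: y_def B_smult[OF T])
    ultimately have "t * t * cmod (ip (T x) x) \<le> numerical_radius V T"
      by (simp add: norm_mult del: of_real_mult)
    then show ?thesis using pos by (simp add: t_def field_simps power2_eq_square)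
  qed
qed

end

section \<open>Rules of the functional calculus\<close>

context positive_op
begin

lemma calc_op_fun: "continuous_on {0..M} h \<Longrightarrow> calc h (op_fun V h P)"
  using calc_exists op_fun_eqI by metis

lemma op_fun_B: "continuous_on {0..M} h \<Longrightarrow> op_fun V h P \<in> B"
  using calc_op_fun has_calculus_B by blast

lemma op_fun_in: "continuous_on {0..M} h \<Longrightarrow> x \<in> C \<Longrightarrow> op_fun V h P x \<in> C"
  using B_in[OF op_fun_B] .

lemma op_fun_cong:
  "continuous_on {0..M} h \<Longrightarrow> (\<And>t. t \<in> {0..M} \<Longrightarrow> h t = k t) \<Longrightarrow> op_fun V h P = op_fun V k P"
  using op_fun_eqI[OF calc_cong[OF calc_op_fun]] by metis

lemma op_fun_mult:
  assumes "continuous_on {0..M} h" "continuous_on {0..M} k" "x \<in> C"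
  shows "op_fun V (\<lambda>t. h t * k t) P x = op_fun V h P (op_fun V k P x)"
  using op_fun_eqI[OF calc_mult[OF calc_op_fun calc_op_fun]] assms by (simp add: compose_def)

lemma op_fun_add:
  assumes "continuous_on {0..M} h" "continuous_on {0..M} k" "x \<in> C"
  shows "op_fun V (\<lambda>t. h t + k t) P x = op_fun V h P x \<oplus> op_fun V k P x"
  using op_fun_eqI[OF calc_add[OF calc_op_fun calc_op_fun]] assms by (simp add: op_add_def)

lemma op_fun_poly: "op_fun V (poly p) P = op_poly V p P"
  by (rule op_fun_eqI[OF calc_poly])

lemma op_fun_const: "x \<in> C \<Longrightarrow> op_fun V (\<lambda>t. c) P x = complex_of_real c \<odot> x"
proof -
  assume x: "x \<in> C"
  have "(\<lambda>t. c) = poly [:c:]" by auto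
  then show ?thesis using op_fun_poly[of "[:c:]"] x by (simp add: op_poly_const[OF P])
qed

lemma op_fun_id: "x \<in> C \<Longrightarrow> op_fun V (\<lambda>t. t) P x = P x"
proof -
  assume x: "x \<in> C"
  have "(\<lambda>t. t) = poly [:0, 1 :: real:]" by auto
  moreover have "op_poly V [:0, 1:] P x = P x"
    using x B_in[OF P] by (simp add: op_poly_pCons[OF P] op_poly_0[OF P] B_zero[OF P])
  ultimately show ?thesis using op_fun_poly[of "[:0, 1:]"] by simp
qed

lemma op_fun_self:
  "continuous_on {0..M} h \<Longrightarrow> x \<in> C \<Longrightarrow> y \<in> C \<Longrightarrow> ip (op_fun V h P x) y = ip x (op_fun V h P y)"
  by (rule calc_self[OF calc_op_fun])

lemma op_fun_bound:
  "continuous_on {0..M} h \<Longrightarrow> (\<And>t. t \<in> {0..M} \<Longrightarrow> \<bar>h t\<bar> \<le> K) \<Longrightarrow> x \<in> C \<Longrightarrow>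
    nrm (op_fun V h P x) \<le> K * nrm x"
  by (rule calc_bound[OF calc_op_fun])

lemma nrm_op_fun_sq:
  assumes "continuous_on {0..M} h" "x \<in> C"
  shows "(nrm (op_fun V h P x))\<^sup>2 = Re (ip (op_fun V (\<lambda>t. h t * h t) P x) x)"
  using assms op_fun_self[OF assms(1) op_fun_in[OF assms] assms(2)]
  by (simp add: nrm_sq op_fun_in op_fun_mult)

text \<open>The form is the squared norm of the image of x under the function
  \<open>sqrt (h t)\<close> of P.\<close>

lemma op_fun_pos:
  assumes h: "continuous_on {0..M} h" and nn: "\<And>t. t \<in> {0..M} \<Longrightarrow> h t \<ge> 0" and x: "x \<in> C"
  shows "0 \<le> Re (ip (op_fun V h P x) x)"
proof -
  have c: "continuous_on {0..M} (\<lambda>t. sqrt (h t))" using h by (intro continuous_intros)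
  have "op_fun V h P = op_fun V (\<lambda>t. sqrt (h t) * sqrt (h t)) P"
    by (rule op_fun_cong[OF h]) (use nn in simp)
  then show ?thesis using nrm_op_fun_sq[OF c x] by (metis zero_le_power2)
qed

text \<open>Makes the calculus available for h(P) itself, with the range bound N as the new
  interval; iterated functions need it.\<close>

lemma positive_op_op_fun:
  assumes h: "continuous_on {0..M} h" and hN: "\<And>t. t \<in> {0..M} \<Longrightarrow> 0 \<le> h t \<and> h t \<le> N"
  shows "positive_op V (op_fun V h P) N"
proof
  show "op_fun V h P \<in> B" by (rule op_fun_B[OF h])
  show "N \<ge> 0" using hN[of 0] M by simp
  fix x assume x: "x \<in> C"
  show "0 \<le> Re (ip (op_fun V h P x) x)" by (rule op_fun_pos[OF h _ x]) (use hN in blast)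
  have "Re (ip (op_fun V h P x) x) \<le> nrm (op_fun V h P x) * nrm x"
    using Re_ip_le[OF op_fun_in[OF h x] x] by simp
  also have "\<dots> \<le> N * nrm x * nrm x"
    using hN x by (intro mult_right_mono op_fun_bound[OF h]) (simp_all add: abs_le_iff order_trans[OF _ M])
  finally show "Re (ip (op_fun V h P x) x) \<le> N * (nrm x)\<^sup>2" by (simp add: power2_eq_square)
qed (rule op_fun_self[OF h])

lemma calc_poly_comp:
  assumes k: "continuous_on {0..M} k"
  shows "calc (\<lambda>t. poly p (k t)) (op_poly V p (op_fun V k P))"
proof (induction p)
  let ?Q = "op_fun V k P"
  note Q = op_fun_B[OF k]
  case 0
  have "op_poly V 0 ?Q = op_poly V 0 P"
    by (rule bounded_ops_eqI[OF op_poly_B[OF Q] op_poly_B[OF P]])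
      (simp add: op_poly_0[OF P] op_poly_0[OF Q])
  then show ?case using calc_poly[of 0] by (simp add: has_calculus_def)
next
  let ?Q = "op_fun V k P"
  note Q = op_fun_B[OF k]
  case (pCons a p)
  have c: "continuous_on {0..M} (\<lambda>t. poly p (k t))" using k by (intro continuous_intros)
  let ?R = "op_add V V (op_poly V [:a:] P) (compose C ?Q (op_poly V p ?Q))"
  have R: "calc (\<lambda>t. poly [:a:] t + k t * poly p (k t)) ?R"
    by (intro calc_add calc_mult calc_poly calc_op_fun k c pCons)
  have "op_poly V (pCons a p) ?Q = ?R"
    by (rule bounded_ops_eqI[OF op_poly_B[OF Q] has_calculus_B[OF R]])
      (simp add: op_add_def compose_def op_poly_pCons[OF Q] op_poly_const[OF P])
  then show ?case using R by simp
qed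

text \<open>The values of k lie in \<open>[0, N]\<close>, so polynomials approximating h there,
  composed with k, approximate the composite uniformly on \<open>[0, M]\<close>.\<close>

lemma op_fun_comp:
  assumes k: "continuous_on {0..M} k" and kN: "\<And>t. t \<in> {0..M} \<Longrightarrow> 0 \<le> k t \<and> k t \<le> N"
    and h: "continuous_on {0..N} h"
  shows "op_fun V h (op_fun V k P) = op_fun V (\<lambda>t. h (k t)) P"
proof -
  interpret Q: positive_op V "op_fun V k P" N by (rule positive_op_op_fun[OF k kN])
  have "calc (\<lambda>t. h (k t)) (op_fun V h (op_fun V k P))"
  proof (rule calc_limit[OF Q.op_fun_B[OF h]])
    fix e :: real assume e: "e > 0"
    obtain p where p: "\<And>t. t \<in> {0..N} \<Longrightarrow> \<bar>poly p t - h t\<bar> \<le> e"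
      "\<And>x. x \<in> C \<Longrightarrow> nrm (op_poly V p (op_fun V k P) x \<ominus> op_fun V h (op_fun V k P) x) \<le> e * nrm x"
      using has_calculusD[OF Q.calc_op_fun[OF h] e] by blast
    show "\<exists>j R. calc j R \<and> (\<forall>t\<in>{0..M}. \<bar>j t - h (k t)\<bar> \<le> e) \<and>
        (\<forall>x\<in>C. nrm (R x \<ominus> op_fun V h (op_fun V k P) x) \<le> e * nrm x)"
      using kN by (intro exI[of _ "\<lambda>t. poly p (k t)"] exI[of _ "op_poly V p (op_fun V k P)"]
          conjI ballI calc_poly_comp[OF k] p) auto
  qed
  then show ?thesis using op_fun_eqI by metis
qed

text \<open>McCarthy's inequality: integrate the tangent to \<open>y \<mapsto> y\<^sup>s\<close> at \<open>\<langle>h(P) x, x\<rangle>\<close>.\<close>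

lemma mccarthy:
  assumes h: "continuous_on {0..M} h" and nn: "\<And>t. t \<in> {0..M} \<Longrightarrow> h t \<ge> 0"
    and s: "s \<ge> 1" and x: "x \<in> C" "nrm x \<le> 1"
  shows "Re (ip (op_fun V h P x) x) powr s \<le> Re (ip (op_fun V (\<lambda>t. h t powr s) P x) x)"
proof -
  let ?E = "\<lambda>k. Re (ip (op_fun V k P x) x)"
  have hs: "continuous_on {0..M} (\<lambda>t. h t powr s)"
    using h nn s by (intro continuous_on_powr' continuous_intros) auto
  define u where "u = ?E h"
  have u0: "u \<ge> 0" unfolding u_def by (rule op_fun_pos[OF h nn x(1)])
  show ?thesis
  \<comment> \<open>No tangent is taken at 0; there \<open>0 powr s = 0\<close>, and the right side
    is nonnegative.\<close>
  proof (cases "u = 0")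
    case True
    then show ?thesis using op_fun_pos[OF hs _ x(1)] by (simp add: u_def[symmetric])
  next
    case False
    then have u: "u > 0" using u0 by simp
    define c where "c = s * u powr (s - 1)"
    define d where "d = u powr s - c * u"
    \<comment> \<open>The tangent at u has slope c and intercept d, so D is the height of the power
      above it.\<close>
    define D where "D = (\<lambda>t. h t powr s - c * h t - d)"
    have D: "continuous_on {0..M} D" unfolding D_def by (intro continuous_intros hs h)
    have ch: "continuous_on {0..M} (\<lambda>t. c * h t)" by (intro continuous_intros h)
    have Dpos: "0 \<le> ?E D"
    proof (rule op_fun_pos[OF D _ x(1)])
      fix t assume "t \<in> {0..M}"
      then show "D t \<ge> 0" using powr_above_tangent[OF u nn s, of t]
        by (simp add: D_def c_def d_def algebra_simps)
    qed
    have "(\<lambda>t. h t powr s) = (\<lambda>t. D t + (c * h t + d))" by (auto simp: D_def)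
    then have "?E (\<lambda>t. h t powr s) = ?E (\<lambda>t. D t + (c * h t + d))" by simp
    also have "\<dots> = ?E D + (?E (\<lambda>t. c * h t) + ?E (\<lambda>t. d))"
      using x D ch by (subst op_fun_add op_fun_add[OF ch]; (intro continuous_intros h)?;
        simp add: op_fun_in continuous_on_const continuous_on_add)+
    also have "?E (\<lambda>t. c * h t) = c * u"
      using x h by (subst op_fun_mult[OF continuous_on_const h]) (simp_all add: op_fun_const op_fun_in u_def)
    also have "?E (\<lambda>t. d) = d * (nrm x)\<^sup>2"
      using x by (simp add: op_fun_const nrm_sq)
    finally have E: "?E (\<lambda>t. h t powr s) \<ge> c * u + d * (nrm x)\<^sup>2" using Dpos by linarith
    \<comment> \<open>The intercept is nonpositive, so shrinking it by the squared norm only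
      increases it. This is why \<open>nrm x \<le> 1\<close> suffices instead of a unit
      vector.\<close>
    have "d = (1 - s) * u powr s" using u by (simp add: d_def c_def powr_diff algebra_simps)
    then have "d \<le> 0" using s by (simp add: mult_nonpos_nonneg)
    moreover have "(nrm x)\<^sup>2 \<le> 1" using x by (simp add: power_le_one)
    ultimately have "d \<le> d * (nrm x)\<^sup>2" using mult_left_mono_neg by fastforce
    then show ?thesis using E by (simp add: u_def[symmetric] d_def)
  qed
qed

end

section \<open>The mixed Schwarz inequality\<close>

context hilbert_space
begin

text \<open>With z the image of y under the adjoint, the squared norm of z is
  \<open>\<langle>T z, y\<rangle>\<close>, and one factor \<open>nrm z\<close> cancels. The same
  constant then serves both compositions with the adjoint.\<close>

lemma adjoint_bound:
  assumes T: "T \<in> B" and c: "c \<ge> 0" "\<And>x. x \<in> C \<Longrightarrow> nrm (T x) \<le> c * nrm x" and y: "y \<in> C"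
  shows "nrm (adjoint_op V V T y) \<le> c * nrm y"
proof -
  define z where "z = adjoint_op V V T y"
  have z: "z \<in> C" using B_in[OF adjoint_B[OF T] y] by (simp add: z_def)
  have "(nrm z)\<^sup>2 = Re (ip (T z) y)" using adjoint[OF T z y] z by (simp add: z_def nrm_sq)
  also have "\<dots> \<le> nrm (T z) * nrm y" using Re_ip_le[OF B_in[OF T z] y] by simp
  also have "\<dots> \<le> c * nrm z * nrm y" using c(2)[OF z] y by (intro mult_right_mono) auto
  finally have "nrm z * nrm z \<le> (c * nrm y) * nrm z" by (simp add: power2_eq_square algebra_simps)
  then show ?thesis
    using c(1) y nrm_nonneg[OF z] unfolding z_def[symmetric] by (cases "nrm z = 0") auto
qed

lemma positive_op_adjoint_compose:
  assumes T: "T \<in> B" and c: "c \<ge> 0" "\<And>x. x \<in> C \<Longrightarrow> nrm (T x) \<le> c * nrm x"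
  shows "positive_op V (compose C (adjoint_op V V T) T) (c\<^sup>2)"
proof
  let ?R = "adjoint_op V V T"
  note [simp] = B_in[OF T] B_in[OF adjoint_B[OF T]]
  have left: "ip (?R (T x)) y = ip (T x) (T y)" if "x \<in> C" "y \<in> C" for x y
    using that adjoint[OF adjoint_B[OF T], of "T x" y] by (simp add: adjoint_adjoint[OF T])
  have right: "ip x (?R (T y)) = ip (T x) (T y)" if "x \<in> C" "y \<in> C" for x y
    using that adjoint[OF T, of x "T y"] by simp
  show "compose C ?R T \<in> B" by (intro compose_B adjoint_B T)
  show "0 \<le> c\<^sup>2" by simp
  fix x assume x: "x \<in> C"
  show "ip (compose C ?R T x) y = ip x (compose C ?R T y)" if "y \<in> C" for y
    using x that by (simp add: compose_def left right)
  show "0 \<le> Re (ip (compose C ?R T x) x)" using x by (simp add: compose_def left)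
  have "(nrm (T x))\<^sup>2 \<le> (c * nrm x)\<^sup>2" using c x by (intro power_mono) auto
  then show "Re (ip (compose C ?R T x) x) \<le> c\<^sup>2 * (nrm x)\<^sup>2"
    using x by (simp add: compose_def left nrm_sq power_mult_distrib)
qed

text \<open>Clear for polynomials by induction, hence for limits. The same polynomials must
  approximate on both sides, so A and D share M.\<close>

lemma op_fun_intertwine:
  assumes A: "positive_op V A M" and D: "positive_op V D M" and S: "S \<in> B"
    and comm: "\<And>x. x \<in> C \<Longrightarrow> S (A x) = D (S x)"
    and h: "continuous_on {0..M} h" and x: "x \<in> C"
  shows "S (op_fun V h A x) = op_fun V h D (S x)"
proof (rule eqI_nrm)
  interpret A: positive_op V A M by fact
  interpret D: positive_op V D M by fact
  note [simp] = B_in[OF S] A.op_poly_in D.op_poly_in A.op_fun_in[OF h] D.op_fun_in[OF h]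
  have poly: "S (op_poly V p A x) = op_poly V p D (S x)" for p
    using x by (induction p)
      (simp_all add: op_poly_0[OF A.P] op_poly_0[OF D.P] op_poly_pCons[OF A.P] op_poly_pCons[OF D.P]
        B_zero[OF S] B_add[OF S] B_smult[OF S] comm B_in[OF A.P])
  obtain K where K: "K \<ge> 0" "\<And>x. x \<in> C \<Longrightarrow> nrm (S x) \<le> K * nrm x" using B_bound[OF S] by blast
  show "nrm (S (op_fun V h A x) \<ominus> op_fun V h D (S x)) \<le> 0"
  proof (rule le_by_epsilon)
    fix e :: real assume e: "e > 0"
    obtain p where p: "\<And>t. t \<in> {0..M} \<Longrightarrow> \<bar>poly p t - h t\<bar> \<le> e"
      "\<And>x. x \<in> C \<Longrightarrow> nrm (op_poly V p A x \<ominus> op_fun V h A x) \<le> e * nrm x"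
      using has_calculusD[OF A.calc_op_fun[OF h] e] by blast
    let ?p = "op_poly V p A x" and ?a = "op_fun V h A x" and ?d = "op_fun V h D (S x)"
    have "nrm (S ?a \<ominus> S ?p) = nrm (S (?p \<ominus> ?a))"
      using x nrm_minus_commute[of "S ?a" "S ?p"] by (simp add: B_minus[OF S])
    also have "\<dots> \<le> K * (e * nrm x)"
      using K(2)[of "?p \<ominus> ?a"] mult_left_mono[OF p(2)[OF x] K(1)] x by simp
    finally have 1: "nrm (S ?a \<ominus> S ?p) \<le> K * (e * nrm x)" .
    have "nrm (op_poly V p D (S x) \<ominus> ?d) \<le> e * nrm (S x)"
      by (rule D.calc_diff_bound[OF D.calc_poly D.calc_op_fun[OF h] p(1)]) (use x in simp_all)
    also have "\<dots> \<le> e * (K * nrm x)" using K(2)[OF x] e by (intro mult_left_mono) auto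
    finally have 2: "nrm (S ?p \<ominus> ?d) \<le> e * (K * nrm x)" by (simp add: poly)
    show "nrm (S ?a \<ominus> ?d) \<le> 0 + (2 * K * nrm x) * e"
      using nrm_triangle_minus_mid[of "S ?a" "S ?p" ?d] 1 2 x by (simp add: algebra_simps)
  qed
qed (use assms B_in[OF S] positive_op.op_fun_in[OF A h] positive_op.op_fun_in[OF D h] in simp_all)

text \<open>The adjoint of S times S is the variable t of the calculus, so the square of the left
  side is the form of the function \<open>t * (h t)\<^sup>2\<close> at x.\<close>

lemma nrm_compose_op_fun_le:
  assumes S: "S \<in> B" and A: "positive_op V (compose C (adjoint_op V V S) S) M"
    and h: "continuous_on {0..M} h" and K: "K \<ge> 0" "\<And>t. t \<in> {0..M} \<Longrightarrow> t * (h t)\<^sup>2 \<le> K\<^sup>2"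
    and x: "x \<in> C"
  shows "nrm (S (op_fun V h (compose C (adjoint_op V V S) S) x)) \<le> K * nrm x"
proof (rule power2_le_imp_le)
  let ?A = "compose C (adjoint_op V V S) S"
  interpret A: positive_op V ?A M by fact
  define z where "z = op_fun V h ?A x"
  have z: "z \<in> C" using x by (simp add: z_def A.op_fun_in[OF h])
  have th: "continuous_on {0..M} (\<lambda>t. t * h t)" by (intro continuous_intros h)
  have hth: "continuous_on {0..M} (\<lambda>t. h t * (t * h t))" by (intro continuous_intros h)
  have "(nrm (S z))\<^sup>2 = Re (ip z (?A z))"
    using adjoint[OF S z B_in[OF S z]] z B_in[OF S z] by (simp add: nrm_sq compose_def)
  also have "?A z = op_fun V (\<lambda>t. t) ?A z" by (simp add: A.op_fun_id[OF z])
  also have "\<dots> = op_fun V (\<lambda>t. t * h t) ?A x"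
    using x by (simp add: z_def A.op_fun_mult[OF continuous_on_id h])
  also have "ip z \<dots> = ip x (op_fun V (\<lambda>t. h t * (t * h t)) ?A x)"
    using x A.op_fun_in[OF th x] by (simp add: z_def A.op_fun_self[OF h] A.op_fun_mult[OF h th])
  also have "Re \<dots> \<le> nrm x * nrm (op_fun V (\<lambda>t. h t * (t * h t)) ?A x)"
    using Re_ip_le[OF x A.op_fun_in[OF hth x]] by simp
  also have "\<dots> \<le> nrm x * (K\<^sup>2 * nrm x)"
  proof (intro mult_left_mono A.op_fun_bound[OF hth] x)
    fix t assume t: "t \<in> {0..M}"
    have eq: "h t * (t * h t) = t * (h t)\<^sup>2" by (simp add: power2_eq_square)
    show "\<bar>h t * (t * h t)\<bar> \<le> K\<^sup>2" unfolding eq using K(2)[OF t] t by simp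
  qed (use x in simp)
  finally show "(nrm (S (op_fun V h ?A x)))\<^sup>2 \<le> (K * nrm x)\<^sup>2"
    by (simp add: z_def power2_eq_square algebra_simps)
qed (use K x in simp)

text \<open>The resolvent-like factor \<open>1 / (|S| + e)\<close> replaces the partial isometry of the polar
  decomposition: \<open>S |S| / (|S| + e) = g(|S*|) (S / (|S| + e)) f(|S|)\<close> with a contraction in the middle.\<close>

lemma mixed_schwarz:
  assumes S: "S \<in> B" and A: "positive_op V (compose C (adjoint_op V V S) S) M"
    and D: "positive_op V (compose C S (adjoint_op V V S)) M"
    and F: "continuous_on {0..M} F" and G: "continuous_on {0..M} G"
    and FG: "\<And>t. t \<in> {0..M} \<Longrightarrow> F t * G t = sqrt t"
    and x: "x \<in> C" and y: "y \<in> C"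
  shows "cmod (ip (S x) y) \<le> nrm (op_fun V F (compose C (adjoint_op V V S) S) x)
    * nrm (op_fun V G (compose C S (adjoint_op V V S)) y)"
proof (rule le_by_epsilon)
  let ?A = "compose C (adjoint_op V V S) S" and ?D = "compose C S (adjoint_op V V S)"
  interpret A: positive_op V ?A M by fact
  interpret D: positive_op V ?D M by fact
  note [simp] = B_in[OF S] A.op_fun_in D.op_fun_in
  fix e :: real assume e: "e > 0"
  \<comment> \<open>The calculus is that of the square of \<bar>S\<bar>, so \<bar>S\<bar> appears as
    \<open>sqrt t\<close>.\<close>
  define r where "r = (\<lambda>t. 1 / (sqrt t + e))"
  have den: "sqrt t + e > 0" if "t \<in> {0..M}" for t using that e by (simp add: add_nonneg_pos)
  have r: "continuous_on {0..M} r" unfolding r_def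
    by (intro continuous_intros) (use den in force)
  have rF: "continuous_on {0..M} (\<lambda>t. r t * F t)" by (intro continuous_intros r F)
  have GrF: "continuous_on {0..M} (\<lambda>t. G t * (r t * F t))" by (intro continuous_intros r F G)
  have er: "continuous_on {0..M} (\<lambda>t. e * r t)" by (intro continuous_intros r)
  have tr: "t * (r t)\<^sup>2 \<le> 1\<^sup>2" if "t \<in> {0..M}" for t
  proof -
    have "sqrt t * r t \<le> 1" "0 \<le> sqrt t * r t" using that e den[OF that] by (simp_all add: r_def)
    then have "(sqrt t * r t)\<^sup>2 \<le> 1\<^sup>2" by (intro power_mono)
    then show ?thesis using that by (simp add: power_mult_distrib)
  qed
  have ter: "t * (e * r t)\<^sup>2 \<le> e\<^sup>2" if "t \<in> {0..M}" for t
    using mult_left_mono[OF tr[OF that], of "e\<^sup>2"] by (simp add: power_mult_distrib algebra_simps)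
  define v where "v = op_fun V F ?A x"
  have v: "v \<in> C" using x F by (simp add: v_def)
  \<comment> \<open>Because \<open>F t * G t = sqrt t\<close>, the identity splits into the product
    of G, r and F and the remainder \<open>e * r\<close>. By \<open>ter\<close>, S maps the
    remainder of x to a vector of norm at most \<open>e * nrm x\<close>.\<close>
  have one: "op_fun V (\<lambda>t. G t * (r t * F t) + e * r t) ?A = op_fun V (\<lambda>t. 1) ?A"
  proof (rule A.op_fun_cong[OF continuous_on_add[OF GrF er]])
    fix t assume t: "t \<in> {0..M}"
    have "G t * (r t * F t) + e * r t = (F t * G t + e) * r t" by (simp add: algebra_simps)
    also have "\<dots> = 1" using FG[OF t] den[OF t] by (simp add: r_def)
    finally show "G t * (r t * F t) + e * r t = 1" .
  qed
  have "x = op_fun V (\<lambda>t. 1) ?A x" using x by (simp add: A.op_fun_const)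
  also have "\<dots> = op_fun V G ?A (op_fun V r ?A v) \<oplus> op_fun V (\<lambda>t. e * r t) ?A x"
    unfolding one[symmetric] using x
    by (simp add: A.op_fun_add[OF GrF er] A.op_fun_mult[OF G rF] A.op_fun_mult[OF r F] v_def)
  finally have x_split: "x = op_fun V G ?A (op_fun V r ?A v) \<oplus> op_fun V (\<lambda>t. e * r t) ?A x" .
  have comm: "S (?A z) = ?D (S z)" if "z \<in> C" for z
    using that B_in[OF adjoint_B[OF S]] by (simp add: compose_def)
  define w where "w = op_fun V r ?A v"
  have w: "w \<in> C" using r v by (simp add: w_def)
  define q where "q = op_fun V (\<lambda>t. e * r t) ?A x"
  have q: "q \<in> C" using er x by (simp add: q_def)
  have int: "S (op_fun V G ?A w) = op_fun V G ?D (S w)"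
    using A D S comm G w by (rule op_fun_intertwine)
  have "S x = S (op_fun V G ?A w \<oplus> q)" using x_split by (simp add: w_def q_def)
  also have "\<dots> = op_fun V G ?D (S w) \<oplus> S q"
    using w q G int by (simp add: B_add[OF S])
  finally have Sx: "S x = op_fun V G ?D (S w) \<oplus> S q" .
  have "cmod (ip (S x) y) = cmod (ip (S w) (op_fun V G ?D y) + ip (S q) y)"
    using w q y G by (simp add: Sx D.op_fun_self[OF G])
  also have "\<dots> \<le> cmod (ip (S w) (op_fun V G ?D y)) + cmod (ip (S q) y)" by (rule norm_triangle_ineq)
  also have "\<dots> \<le> nrm (S w) * nrm (op_fun V G ?D y) + nrm (S q) * nrm y"
    using w q y G by (intro add_mono cauchy_schwarz) simp_all
  \<comment> \<open>S after the function r is a contraction, since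
    \<open>sqrt t * r t \<le> 1\<close>.\<close>
  also have "\<dots> \<le> (1 * nrm v) * nrm (op_fun V G ?D y) + (e * nrm x) * nrm y"
    unfolding w_def q_def using e x y v G
    by (intro add_mono mult_right_mono nrm_compose_op_fun_le[OF S A r _ tr]
        nrm_compose_op_fun_le[OF S A er _ ter]) simp_all
  finally show "cmod (ip (S x) y) \<le> nrm (op_fun V F ?A x) * nrm (op_fun V G ?D y) + (nrm x * nrm y) * e"
    by (simp add: v_def algebra_simps)
qed

end

section \<open>Diagonal entries\<close>

lemma (in positive_op) op_powr_op_fun_sqrt:
  assumes f: "continuous_on {0..} f" "\<And>t. t \<ge> 0 \<Longrightarrow> f t \<ge> 0" and r: "r > 0"
  shows "op_powr V (op_fun V f (op_powr V P (1/2))) r = op_fun V (\<lambda>t. f (sqrt t) powr r) P"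
    and "continuous_on {0..M} (\<lambda>t. f (sqrt t))"
proof -
  have sq: "continuous_on {0..M} sqrt" by (intro continuous_intros)
  \<comment> \<open>Three nested calculi are merged from the inside out, each on an interval that
    contains the range of the function before it.\<close>
  have half: "op_powr V P (1/2) = op_fun V sqrt P"
    unfolding op_powr_def by (rule op_fun_cong[OF sq, symmetric]) (simp add: powr_half_sqrt)
  have comp: "op_fun V f (op_fun V sqrt P) = op_fun V (\<lambda>t. f (sqrt t)) P"
    by (rule op_fun_comp[OF sq, where N = "sqrt M"]) (auto intro: continuous_on_subset[OF f(1)])
  show fs: "continuous_on {0..M} (\<lambda>t. f (sqrt t))"
    by (rule continuous_on_compose2[OF f(1) sq]) auto
  obtain N where N: "\<And>t. t \<in> {0..M} \<Longrightarrow> \<bar>f (sqrt t)\<bar> \<le> N"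
    using continuous_on_interval_bound[OF fs] by blast
  have "op_fun V (\<lambda>u. u powr r) (op_fun V (\<lambda>t. f (sqrt t)) P) = op_fun V (\<lambda>t. f (sqrt t) powr r) P"
  proof (rule op_fun_comp[OF fs, where N = N])
    fix t assume t: "t \<in> {0..M}"
    then show "0 \<le> f (sqrt t) \<and> f (sqrt t) \<le> N" using N[OF t] f(2)[of "sqrt t"] by simp
  next
    show "continuous_on {0..N} (\<lambda>u. u powr r)"
      using r by (intro continuous_on_powr' continuous_intros) auto
  qed
  then show "op_powr V (op_fun V f (op_powr V P (1/2))) r = op_fun V (\<lambda>t. f (sqrt t) powr r) P"
    unfolding half comp by (simp add: op_powr_def)
qed

lemma (in hilbert_space)
  assumes S: "S \<in> B"
    and f: "continuous_on {0..} f" "\<And>t. t \<ge> 0 \<Longrightarrow> f t \<ge> 0"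
    and g: "continuous_on {0..} g" "\<And>t. t \<ge> 0 \<Longrightarrow> g t \<ge> 0"
    and fg: "\<And>t. t \<ge> 0 \<Longrightarrow> f t * g t = t"
    and s: "s \<ge> 1"
  shows diagonal_entry_nonneg: "0 \<le> numerical_radius V (op_add V V
      (op_powr V (op_fun V f (op_abs V V S)) (2 * s))
      (op_powr V (op_fun V g (op_abs V V (adjoint_op V V S))) (2 * s)))"
    and diagonal_entry_bound: "x \<in> C \<Longrightarrow> nrm x \<le> 1 \<Longrightarrow>
      cmod (ip (S x) x) powr s \<le> 1/2 * numerical_radius V (op_add V V
      (op_powr V (op_fun V f (op_abs V V S)) (2 * s))
      (op_powr V (op_fun V g (op_abs V V (adjoint_op V V S))) (2 * s))) * (nrm x)\<^sup>2"
proof -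
  let ?w = "numerical_radius V (op_add V V
    (op_powr V (op_fun V f (op_abs V V S)) (2 * s))
    (op_powr V (op_fun V g (op_abs V V (adjoint_op V V S))) (2 * s)))"
  let ?S' = "adjoint_op V V S"
  let ?A = "compose C ?S' S" and ?D = "compose C S ?S'"
  define c where "c = op_norm V V S"
  have c: "c \<ge> 0" "\<And>x. x \<in> C \<Longrightarrow> nrm (S x) \<le> c * nrm x"
    using op_norm_nonneg_bound[OF complex_hilbert complex_hilbert S] by (auto simp: c_def)
  have pA: "positive_op V ?A (c\<^sup>2)" by (rule positive_op_adjoint_compose[OF S c])
  \<comment> \<open>The adjoint obeys the same bound c, so both compositions have the interval
    \<open>[0, c\<^sup>2]\<close>.\<close>
  have pD: "positive_op V ?D (c\<^sup>2)"
    using positive_op_adjoint_compose[OF adjoint_B[OF S] c(1) adjoint_bound[OF S c]]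
    by (simp add: adjoint_adjoint[OF S])
  interpret A: positive_op V ?A "c\<^sup>2" by fact
  interpret D: positive_op V ?D "c\<^sup>2" by fact
  define F where "F = (\<lambda>t. f (sqrt t))"
  define G where "G = (\<lambda>t. g (sqrt t))"
  have s2: "2 * s > 0" using s by simp
  have F: "continuous_on {0..c\<^sup>2} F" and fA: "op_powr V (op_fun V f (op_abs V V S)) (2 * s) = op_fun V (\<lambda>t. F t powr (2 * s)) ?A"
    using A.op_powr_op_fun_sqrt[OF f s2] by (simp_all add: F_def op_abs_def)
  have G: "continuous_on {0..c\<^sup>2} G" and gD: "op_powr V (op_fun V g (op_abs V V ?S')) (2 * s) = op_fun V (\<lambda>t. G t powr (2 * s)) ?D"
    using D.op_powr_op_fun_sqrt[OF g s2] by (simp_all add: G_def op_abs_def adjoint_adjoint[OF S])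
  have Fs: "continuous_on {0..c\<^sup>2} (\<lambda>t. F t powr (2 * s))"
    using s f(2) by (intro continuous_on_powr' continuous_intros F) (auto simp: F_def)
  have Gs: "continuous_on {0..c\<^sup>2} (\<lambda>t. G t powr (2 * s))"
    using s g(2) by (intro continuous_on_powr' continuous_intros G) (auto simp: G_def)
  let ?T = "op_add V V (op_fun V (\<lambda>t. F t powr (2 * s)) ?A) (op_fun V (\<lambda>t. G t powr (2 * s)) ?D)"
  have T: "?T \<in> B" by (intro op_add_B A.op_fun_B D.op_fun_B Fs Gs)
  show "0 \<le> ?w" unfolding fA gD by (rule numerical_radius_nonneg[OF T])
  assume x: "x \<in> C" "nrm x \<le> 1"
  define a where "a = nrm (op_fun V F ?A x)"
  define b where "b = nrm (op_fun V G ?D x)"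
  have ab: "a \<ge> 0" "b \<ge> 0" using A.op_fun_in[OF F x(1)] D.op_fun_in[OF G x(1)] by (auto simp: a_def b_def)
  have pow: "(u * u) powr s = u powr (2 * s)" if "u \<ge> 0" for u :: real
    using that by (simp add: powr_mult flip: powr_add)
  have "(a\<^sup>2) powr s \<le> Re (ip (op_fun V (\<lambda>t. (F t * F t) powr s) ?A x) x)"
    unfolding a_def A.nrm_op_fun_sq[OF F x(1)]
    by (rule A.mccarthy[OF continuous_on_mult[OF F F] _ s x]) simp
  also have "op_fun V (\<lambda>t. (F t * F t) powr s) ?A = op_fun V (\<lambda>t. F t powr (2 * s)) ?A"
    by (rule A.op_fun_cong[OF Fs, symmetric]) (use f(2) in \<open>simp add: F_def pow\<close>)
  finally have 1: "(a\<^sup>2) powr s \<le> Re (ip (op_fun V (\<lambda>t. F t powr (2 * s)) ?A x) x)" .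
  have "(b\<^sup>2) powr s \<le> Re (ip (op_fun V (\<lambda>t. (G t * G t) powr s) ?D x) x)"
    unfolding b_def D.nrm_op_fun_sq[OF G x(1)]
    by (rule D.mccarthy[OF continuous_on_mult[OF G G] _ s x]) simp
  also have "op_fun V (\<lambda>t. (G t * G t) powr s) ?D = op_fun V (\<lambda>t. G t powr (2 * s)) ?D"
    by (rule D.op_fun_cong[OF Gs, symmetric]) (use g(2) in \<open>simp add: G_def pow\<close>)
  finally have 2: "(b\<^sup>2) powr s \<le> Re (ip (op_fun V (\<lambda>t. G t powr (2 * s)) ?D x) x)" .
  have "cmod (ip (S x) x) \<le> a * b"
    unfolding a_def b_def
  proof (rule mixed_schwarz[OF S pA pD F G _ x(1) x(1)])
    fix t assume "t \<in> {0..c\<^sup>2}"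
    then show "F t * G t = sqrt t" using fg[of "sqrt t"] by (simp add: F_def G_def)
  qed
  then have "cmod (ip (S x) x) powr s \<le> (a * b) powr s" using s by (intro powr_mono2) auto
  \<comment> \<open>AM-GM for the s-th powers of a and b; this is the factor 1/2 of the diagonal
    entries.\<close>
  also have "\<dots> \<le> ((a powr s)\<^sup>2 + (b powr s)\<^sup>2) / 2"
    using ab sum_squares_bound[of "a powr s" "b powr s"] by (simp add: powr_mult)
  also have "\<dots> = ((a\<^sup>2) powr s + (b\<^sup>2) powr s) / 2"
    using ab by (simp add: power2_eq_square powr_mult)
  also have "\<dots> \<le> Re (ip (?T x) x) / 2"
    using 1 2 x A.op_fun_in[OF Fs x(1)] D.op_fun_in[OF Gs x(1)] by (simp add: op_add_def)
  also have "\<dots> \<le> numerical_radius V ?T * (nrm x)\<^sup>2 / 2"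
    using numerical_radius_bound[OF T x(1)] complex_Re_le_cmod[of "ip (?T x) x"] by simp
  finally show "cmod (ip (S x) x) powr s \<le> 1/2 * ?w * (nrm x)\<^sup>2" unfolding fA gD by simp
qed

section \<open>Operator matrices\<close>

lemma (in hilbert_space) ip_finsum_left:
  assumes "finite I" "\<And>j. j \<in> I \<Longrightarrow> u j \<in> C" "z \<in> C"
  shows "ip (finsum V u I) z = (\<Sum>j\<in>I. ip (u j) z)"
  using assms
proof (induction I)
  case (insert j I)
  have 1: "u \<in> I \<rightarrow> C" "u j \<in> C" using insert.prems by auto
  have "finsum V u (insert j I) = u j \<oplus> finsum V u I"
    by (rule module.M.finsum_insert[OF insert.hyps 1])
  then show ?case
    using insert 1 module.M.finsum_closed[OF 1(1)] by simp
qed simp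

section \<open>Forms of complex matrices\<close>

lemma carrier_cvec_space: "carrier (cvec_space n) = carrier_vec n"
  by (simp add: cvec_space_def module.extend_def cinner_space.fields_def module_vec_def)

lemma cinner_cvec_space:
  assumes "w \<in> carrier_vec n"
  shows "cinner (cvec_space n) u w = (\<Sum>i<n. vec_index u i * cnj (vec_index w i))"
  using assms by (simp add: cvec_space_def module.extend_def cinner_space.fields_def module_vec_def
      scalar_prod_def atLeast0LessThan)

lemma hnorm_cvec_space:
  assumes "v \<in> carrier_vec n"
  shows "(hnorm (cvec_space n) v)\<^sup>2 = (\<Sum>i<n. (cmod (vec_index v i))\<^sup>2)"
proof -
  have "Re (cinner (cvec_space n) v v) = (\<Sum>i<n. (cmod (vec_index v i))\<^sup>2)"
    by (simp only: cinner_cvec_space[OF assms] complex_norm_square[symmetric] Re_sum Re_complex_of_real)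
  then show ?thesis by (simp add: hnorm_def sum_nonneg)
qed

text \<open>A real supremum is informative only for a bounded set. Coordinates of a unit vector have
  modulus at most 1, so the sum of the moduli of all entries is a bound.\<close>

lemma
  fixes A :: "complex mat"
  assumes A: "A \<in> carrier_mat n n"
  shows numerical_radius_mat_op_nonneg: "0 \<le> numerical_radius (cvec_space n) (mat_op n A)"
    and numerical_radius_mat_op_upper: "v \<in> carrier_vec n \<Longrightarrow> hnorm (cvec_space n) v = 1 \<Longrightarrow>
      cmod (\<Sum>i<n. (\<Sum>j<n. A $$ (i, j) * vec_index v j) * cnj (vec_index v i))
      \<le> numerical_radius (cvec_space n) (mat_op n A)"
proof -
  let ?q = "\<lambda>v. \<Sum>i<n. (\<Sum>j<n. A $$ (i, j) * vec_index v j) * cnj (vec_index v i)"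
  have q: "cinner (cvec_space n) (mat_op n A v) v = ?q v" if v: "v \<in> carrier_vec n" for v
  proof -
    have "vec_index (A *\<^sub>v v) i = (\<Sum>j<n. A $$ (i, j) * vec_index v j)" if "i < n" for i
      using that A v by (simp add: scalar_prod_def atLeast0LessThan)
    then show ?thesis using v by (simp add: cinner_cvec_space mat_op_def carrier_cvec_space)
  qed
  let ?S = "insert 0 {cmod (cinner (cvec_space n) (mat_op n A v) v) | v.
    v \<in> carrier (cvec_space n) \<and> hnorm (cvec_space n) v = 1}"
  have bdd: "bdd_above ?S"
  proof (rule bdd_aboveI)
    fix r assume "r \<in> ?S"
    then consider "r = 0" | v where "v \<in> carrier_vec n" "hnorm (cvec_space n) v = 1" "r = cmod (?q v)"
      using q carrier_cvec_space by auto
    then show "r \<le> (\<Sum>i<n. \<Sum>j<n. cmod (A $$ (i, j)))"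
    proof cases
      case 2
      have le1: "cmod (vec_index v i) \<le> 1" if "i < n" for i
      proof -
        have "(cmod (vec_index v i))\<^sup>2 \<le> (\<Sum>i<n. (cmod (vec_index v i))\<^sup>2)"
          by (rule member_le_sum) (use that in auto)
        also have "\<dots> = 1" using hnorm_cvec_space[OF 2(1)] 2(2) by simp
        finally show ?thesis by (simp add: abs_square_le_1)
      qed
      have "cmod (?q v) \<le> (\<Sum>i<n. cmod ((\<Sum>j<n. A $$ (i, j) * vec_index v j) * cnj (vec_index v i)))"
        by (rule norm_sum)
      also have "\<dots> \<le> (\<Sum>i<n. \<Sum>j<n. cmod (A $$ (i, j)))"
      proof (rule sum_mono)
        fix i assume "i \<in> {..<n}"
        then have i: "i < n" by simp
        have "cmod (\<Sum>j<n. A $$ (i, j) * vec_index v j) \<le> (\<Sum>j<n. cmod (A $$ (i, j) * vec_index v j))"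
          by (rule norm_sum)
        also have "\<dots> \<le> (\<Sum>j<n. cmod (A $$ (i, j)))"
          by (intro sum_mono) (use le1 in \<open>auto simp: norm_mult intro!: mult_left_le\<close>)
        finally have "cmod (\<Sum>j<n. A $$ (i, j) * vec_index v j) * cmod (vec_index v i)
            \<le> (\<Sum>j<n. cmod (A $$ (i, j))) * 1"
          using le1[OF i] by (intro mult_mono) (auto intro: sum_nonneg)
        then show "cmod ((\<Sum>j<n. A $$ (i, j) * vec_index v j) * cnj (vec_index v i))
            \<le> (\<Sum>j<n. cmod (A $$ (i, j)))" by (simp add: norm_mult)
      qed
      finally show ?thesis using 2(3) by simp
    qed (simp add: sum_nonneg)
  qed
  show "0 \<le> numerical_radius (cvec_space n) (mat_op n A)"
    unfolding numerical_radius_def by (rule cSup_upper[OF _ bdd]) simp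
  show "cmod (?q v) \<le> numerical_radius (cvec_space n) (mat_op n A)"
    if "v \<in> carrier_vec n" "hnorm (cvec_space n) v = 1"
    unfolding numerical_radius_def using that carrier_cvec_space q[OF that(1)]
    by (intro cSup_upper[OF _ bdd]) auto
qed

text \<open>The nonnegative numbers y are the coordinates of a unit vector, and the form there is
  real and nonnegative, hence equal to its modulus.\<close>

lemma nonneg_form_le_numerical_radius:
  fixes a :: "nat \<Rightarrow> nat \<Rightarrow> real"
  assumes a: "\<And>i j. i < n \<Longrightarrow> j < n \<Longrightarrow> a i j \<ge> 0"
    and y: "\<And>i. i < n \<Longrightarrow> y i \<ge> 0" "(\<Sum>i<n. (y i)\<^sup>2) = 1"
  shows "(\<Sum>i<n. \<Sum>j<n. a i j * y j * y i)
    \<le> numerical_radius (cvec_space n) (mat_op n (Matrix.mat n n (\<lambda>(i, j). complex_of_real (a i j))))"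
proof -
  let ?A = "Matrix.mat n n (\<lambda>(i, j). complex_of_real (a i j))"
  define v where "v = Matrix.vec n (\<lambda>i. complex_of_real (y i))"
  have v: "v \<in> carrier_vec n" by (simp add: v_def)
  have "(hnorm (cvec_space n) v)\<^sup>2 = 1" using y(2) by (simp add: hnorm_cvec_space[OF v]) (simp add: v_def)
  moreover have "hnorm (cvec_space n) v \<ge> 0"
  proof -
    have "Re (cinner (cvec_space n) v v) \<ge> 0"
      unfolding cinner_cvec_space[OF v] by (auto intro!: sum_nonneg add_nonneg_nonneg)
    then show ?thesis by (simp add: hnorm_def)
  qed
  ultimately have "hnorm (cvec_space n) v = 1" by (simp add: power2_eq_1_iff)
  then have "cmod (\<Sum>i<n. (\<Sum>j<n. ?A $$ (i, j) * vec_index v j) * cnj (vec_index v i))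
      \<le> numerical_radius (cvec_space n) (mat_op n ?A)"
    by (intro numerical_radius_mat_op_upper v) simp_all
  moreover have "(\<Sum>i<n. (\<Sum>j<n. ?A $$ (i, j) * vec_index v j) * cnj (vec_index v i))
      = complex_of_real (\<Sum>i<n. \<Sum>j<n. a i j * y j * y i)"
    by (simp add: v_def sum_distrib_right)
  moreover have "(\<Sum>i<n. \<Sum>j<n. a i j * y j * y i) \<ge> 0"
    using a y by (intro sum_nonneg mult_nonneg_nonneg) auto
  ultimately show ?thesis by (simp only: norm_of_real abs_of_nonneg)
qed

theorem theorem3p2:
  fixes n :: nat
    and H :: "nat \<Rightarrow> 'a cinner_space"
    and S :: "nat \<Rightarrow> nat \<Rightarrow> 'a \<Rightarrow> 'a"
    and f g :: "real \<Rightarrow> real"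
    and s :: real
  assumes "n \<ge> 1"
    and "\<And>i. i < n \<Longrightarrow> complex_hilbert (H i)"
    and "\<And>i j. \<lbrakk>i < n; j < n\<rbrakk> \<Longrightarrow> S i j \<in> bounded_ops (H j) (H i)"
    and "continuous_on {0..} f" and "continuous_on {0..} g"
    and "\<And>t. t \<ge> 0 \<Longrightarrow> f t \<ge> 0" and "\<And>t. t \<ge> 0 \<Longrightarrow> g t \<ge> 0"
    and "\<And>t. t \<ge> 0 \<Longrightarrow> f t * g t = t"
    and "s \<ge> 1"
  shows "numerical_radius (hilbert_sum {..<n} H) (op_matrix {..<n} H S) powr s
    \<le> real n powr (2 * s - 2) *
       numerical_radius (cvec_space n) (mat_op n (Matrix.mat n n (\<lambda>(i, j). complex_of_real
         (if i = j
          then 1/2 * numerical_radius (H i)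
                 (op_add (H i) (H i)
                   (op_powr (H i) (op_fun (H i) f (op_abs (H i) (H i) (S i i))) (2 * s))
                   (op_powr (H i) (op_fun (H i) g
                      (op_abs (H i) (H i) (adjoint_op (H i) (H i) (S i i)))) (2 * s)))
          else op_norm (H j) (H i) (S i j) powr s))))"
proof -
  define d where "d = (\<lambda>i. 1/2 * numerical_radius (H i)
    (op_add (H i) (H i)
      (op_powr (H i) (op_fun (H i) f (op_abs (H i) (H i) (S i i))) (2 * s))
      (op_powr (H i) (op_fun (H i) g
         (op_abs (H i) (H i) (adjoint_op (H i) (H i) (S i i)))) (2 * s))))"
  define a where "a = (\<lambda>i j. if i = j then d i else op_norm (H j) (H i) (S i j) powr s)"
  let ?HS = "hilbert_sum {..<n} H" and ?T = "op_matrix {..<n} H S"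
  let ?\<Omega> = "numerical_radius (cvec_space n)
    (mat_op n (Matrix.mat n n (\<lambda>(i, j). complex_of_real (a i j))))"
  note hilb = assms(2) and S = assms(3)
  have a_nonneg: "a i j \<ge> 0" if "i < n" "j < n" for i j
    using hilbert_space.diagonal_entry_nonneg[OF hilbert_spaceI[OF hilb] S assms(4,6,5,7,8,9), of i] that
    by (cases "i = j") (simp_all add: a_def d_def)
  \<comment> \<open>The diagonal bound is for \<open>\<langle>T u, u\<rangle>\<close>, hence the
    condition that u and w agree when \<open>i = j\<close>.\<close>
  have entry: "cmod (cinner (H i) (S i j u) w) powr s
      \<le> a i j * hnorm (H j) u * hnorm (H i) w"
    if ij: "i < n" "j < n" and u: "u \<in> carrier (H j)" "hnorm (H j) u \<le> 1"
      and w: "w \<in> carrier (H i)" "hnorm (H i) w \<le> 1" and diag: "i = j \<Longrightarrow> u = w" for i j u w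
  proof (cases "i = j")
    case True
    interpret hilbert_space "H i" by (rule hilbert_spaceI[OF hilb[OF ij(1)]])
    show ?thesis
      using diagonal_entry_bound[OF S[OF ij(1,1)] assms(4,6,5,7,8,9) w] True diag
      by (simp add: a_def d_def power2_eq_square mult.assoc)
  next
    case False
    interpret Hi: hilbert_space "H i" by (rule hilbert_spaceI[OF hilb[OF ij(1)]])
    interpret Hj: hilbert_space "H j" by (rule hilbert_spaceI[OF hilb[OF ij(2)]])
    let ?N = "op_norm (H j) (H i) (S i j)"
    define z where "z = hnorm (H j) u * hnorm (H i) w"
    have N: "?N \<ge> 0" by (rule op_norm_nonneg[OF hilb[OF ij(2)] hilb[OF ij(1)] S[OF ij]])
    have z: "z \<ge> 0" "z \<le> 1" using u w by (auto simp: z_def intro: mult_le_one)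
    have "cmod (cinner (H i) (S i j u) w) \<le> hnorm (H i) (S i j u) * hnorm (H i) w"
      by (rule Hi.cauchy_schwarz[OF bounded_ops_in[OF S[OF ij] u(1)] w(1)])
    also have "\<dots> \<le> ?N * hnorm (H j) u * hnorm (H i) w"
      using op_norm_bound[OF hilb[OF ij(2)] hilb[OF ij(1)] S[OF ij] u(1)] w
      by (intro mult_right_mono) auto
    finally have "cmod (cinner (H i) (S i j u) w) powr s \<le> (?N * z) powr s"
      using assms(9) by (intro powr_mono2) (auto simp: z_def mult.assoc)
    also have "\<dots> = ?N powr s * z powr s" using N z by (simp add: powr_mult)
    \<comment> \<open>\<open>z \<le> 1\<close> and \<open>s \<ge> 1\<close> remove the power,
      leaving the norm of each component linear as in a bilinear form.\<close>
    also have "\<dots> \<le> ?N powr s * z"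
      using powr_mono'[of 1 s z] z assms(9) by (intro mult_left_mono) auto
    finally show ?thesis using False by (simp add: a_def z_def mult.assoc)
  qed
  have bound: "cmod (cinner ?HS (?T x) x) powr s \<le> real n powr (2 * s - 2) * ?\<Omega>"
    if x: "x \<in> carrier ?HS" "hnorm ?HS x = 1" for x
  proof -
    have xi: "x i \<in> carrier (H i)" if "i < n" for i
      using x(1) that by (auto simp: hilbert_sum_def)
    define y where "y = (\<lambda>i. hnorm (H i) (x i))"
    have y: "y i \<ge> 0" "(y i)\<^sup>2 = Re (cinner (H i) (x i) (x i))" if "i < n" for i
    proof -
      interpret hilbert_space "H i" by (rule hilbert_spaceI[OF hilb[OF that]])
      show "y i \<ge> 0" "(y i)\<^sup>2 = Re (cinner (H i) (x i) (x i))"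
        using xi[OF that] by (simp_all add: y_def nrm_sq)
    qed
    have y1: "(\<Sum>i<n. (y i)\<^sup>2) = 1" using x(2) y by (simp add: hilbert_sum_def hnorm_def)
    have yle: "y i \<le> 1" if "i < n" for i
    proof -
      have "(y i)\<^sup>2 \<le> (\<Sum>i<n. (y i)\<^sup>2)" by (rule member_le_sum) (use that in auto)
      then have "(y i)\<^sup>2 \<le> 1\<^sup>2" by (simp only: y1) simp
      then show ?thesis by (rule power2_le_imp_le) simp
    qed
    define t where "t = (\<lambda>(i, j). cmod (cinner (H i) (S i j (x j)) (x i)))"
    have "cinner ?HS (?T x) x = (\<Sum>i<n. \<Sum>j<n. cinner (H i) (S i j (x j)) (x i))"
    proof -
      have "cinner (H i) (finsum (H i) (\<lambda>j. S i j (x j)) {..<n}) (x i)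
          = (\<Sum>j<n. cinner (H i) (S i j (x j)) (x i))" if "i < n" for i
      proof -
        interpret hilbert_space "H i" by (rule hilbert_spaceI[OF hilb[OF that]])
        show ?thesis using xi that bounded_ops_in[OF S] by (intro ip_finsum_left) auto
      qed
      then show ?thesis using x(1) by (simp add: hilbert_sum_def op_matrix_def)
    qed
    also have "\<dots> = (\<Sum>(i, j)\<in>{..<n} \<times> {..<n}. cinner (H i) (S i j (x j)) (x i))"
      by (simp add: sum.cartesian_product)
    finally have "cmod (cinner ?HS (?T x) x) \<le> (\<Sum>p\<in>{..<n} \<times> {..<n}. t p)"
      unfolding t_def by (simp add: case_prod_beta norm_sum)
    then have "cmod (cinner ?HS (?T x) x) powr s \<le> (\<Sum>p\<in>{..<n} \<times> {..<n}. t p) powr s"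
      using assms(9) by (intro powr_mono2) auto
    also have "\<dots> \<le> real (card ({..<n} \<times> {..<n})) powr (s - 1) * (\<Sum>p\<in>{..<n} \<times> {..<n}. t p powr s)"
      by (rule sum_powr_le) (auto simp: t_def assms(9))
    also have "real (card ({..<n} \<times> {..<n})) powr (s - 1) = real n powr (2 * s - 2)"
      by (simp add: powr_mult card_cartesian_product flip: powr_add)
    also have "(\<Sum>p\<in>{..<n} \<times> {..<n}. t p powr s) = (\<Sum>i<n. \<Sum>j<n. t (i, j) powr s)"
      by (simp add: sum.cartesian_product case_prod_beta)
    also have "real n powr (2 * s - 2) * \<dots> \<le> real n powr (2 * s - 2) * (\<Sum>i<n. \<Sum>j<n. a i j * y j * y i)"
      using entry xi yle by (intro mult_left_mono sum_mono) (auto simp: t_def y_def)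
    also have "\<dots> \<le> real n powr (2 * s - 2) * ?\<Omega>"
      by (intro mult_left_mono nonneg_form_le_numerical_radius) (use a_nonneg y y1 in auto)
    finally show ?thesis .
  qed
  define K where "K = real n powr (2 * s - 2) * ?\<Omega>"
  have K: "K \<ge> 0"
    unfolding K_def by (intro mult_nonneg_nonneg numerical_radius_mat_op_nonneg) simp_all
  let ?R = "insert 0 {cmod (cinner ?HS (?T x) x) | x. x \<in> carrier ?HS \<and> hnorm ?HS x = 1}"
  \<comment> \<open>Taking s-th roots of the pointwise bound lets it pass to the supremum, and it
    also supplies the boundedness that \<open>cSup_upper\<close> requires.\<close>
  have R_le: "r \<le> K powr (1 / s)" if "r \<in> ?R" for r
  proof -
    from that consider "r = 0" | "r \<ge> 0" "r powr s \<le> K" using bound by (auto simp: K_def)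
    then show ?thesis
    proof cases
      case 2
      then have "(r powr s) powr (1 / s) \<le> K powr (1 / s)" using assms(9) by (intro powr_mono2) auto
      then show ?thesis using 2 assms(9) by (simp add: powr_powr)
    qed simp
  qed
  have "numerical_radius ?HS ?T \<le> K powr (1 / s)"
    unfolding numerical_radius_def by (rule cSup_least[OF _ R_le]) simp_all
  \<comment> \<open>Guaranteed by the inserted 0, the only member if there is no unit vector;
    monotonicity of \<open>powr\<close> relies on it.\<close>
  moreover have "numerical_radius ?HS ?T \<ge> 0"
    unfolding numerical_radius_def by (rule cSup_upper[OF _ bdd_aboveI[OF R_le]]) simp_all
  ultimately have "numerical_radius ?HS ?T powr s \<le> (K powr (1 / s)) powr s"
    using assms(9) by (intro powr_mono2) auto
  also have "\<dots> = K" using K assms(9) by (simp add: powr_powr)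
  finally show ?thesis unfolding K_def a_def d_def .
qed

end
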